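(* Let $(M,g)$ be a smooth Riemannian manifold of dimension $n$ and let $1\le p\le n$. If $n<2p$, then $$D^{p,p}=g^{2p-n}D^{n-p,n-p}.$$ In particular, if $\omega=\sum_{i=0}^{p}g^i\omega_{p-i}\in D^{p,p}$ (with $\omega_{p-i}\in E^{p-i,p-i}$) is the decomposition of a double form $\omega$ following the orthogonal splitting $D^{p,p}=E^{p,p}\oplus gE^{p-1,p-1}\oplus g^2E^{p-2,p-2}\oplus\dots\oplus g^pE^{0,0}$, then $$\omega_k=0\quad\text{for } n-p<k\le p.$$
   Context: $D^{p,p}=\Lambda^{*p}M\otimes\Lambda^{*p}M$ denotes the bundle of double forms of degree $p$, where $\Lambda^{*p}M$ is the bundle of differential $p$-forms; its sections are also called double forms of degree (order) $p$. $D^{0,0}$ is the trivial line bundle (functions). The product of double forms is the exterior (Kulkarni-Nomizu) product $(\theta_1\otimes\theta_2)(\theta_3\otimes\theta_4)=(\theta_1\wedge\theta_3)\otimes(\theta_2\wedge\theta_4)$, and powers $g^i$ of the metric $g\in D^{1,1}$ are taken with respect to it. The Ricci contraction $c:D^{p,p}\to D^{p-1,p-1}$ is $c\omega(x_2,\dots,x_p;y_2,\dots,y_p)=\sum_{j=1}^n\omega(e_j,x_2,\dots,x_p;e_j,y_2,\dots,y_p)$ for an orthonormal basis $(e_j)$ of the tangent space, with $c=0$ on $D^{0,0}$. $E^{r,r}=\ker c\subset D^{r,r}$ is the bundle of trace free double forms of order $r$. For $1\le p\le n$ one has the orthogonal decomposition $D^{p,p}=E^{p,p}\oplus gE^{p-1,p-1}\oplus\dots\oplus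 g^pE^{0,0}$. In this decomposition, "$\omega_k=0$" means that the component $g^{p-k}\omega_k$ of $\omega$ in the summand $g^{p-k}E^{k,k}$ vanishes. *)

theory Defs
  imports
    "HOL-Analysis.Analysis"
    "HOL-Library.Function_Algebras"
    "HOL-Combinatorics.Permutations"
begin

section \<open>Pointwise real vector space structure on functions\<close>

instantiation "fun" :: (type, real_vector) real_vector
begin

definition scaleR_fun_def: "a *\<^sub>R f = (\<lambda>x. a *\<^sub>R f x)"

instance
  by standard (simp_all add: scaleR_fun_def fun_eq_iff scaleR_add_right scaleR_add_left)

end


section \<open>Smooth manifolds and Riemannian metrics\<close>

text \<open>\<open>C\<^sup>\<infinity>\<close> maps on open subsets of a Euclidean space: all iterated directional
  derivatives exist and are continuous.\<close>

primrec Ck_on :: "nat \<Rightarrow> 'a::euclidean_space set \<Rightarrow> ('a \<Rightarrow> 'b::real_normed_vector) \<Rightarrow> bool" where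
  "Ck_on 0 S f \<longleftrightarrow> continuous_on S f"
| "Ck_on (Suc k) S f \<longleftrightarrow>
     (\<forall>x\<in>S. f differentiable (at x)) \<and>
     (\<forall>v. Ck_on k S (\<lambda>x. frechet_derivative f (at x) v))"

definition smooth_on :: "'a::euclidean_space set \<Rightarrow> ('a \<Rightarrow> 'b::real_normed_vector) \<Rightarrow> bool" where
  "smooth_on S f \<longleftrightarrow> (\<forall>k. Ck_on k S f)"

text \<open>A chart is a pair of its domain and its coordinate map; the values of the map outside
  the domain are irrelevant.\<close>

type_synonym ('m, 'e) chart = "'m set \<times> ('m \<Rightarrow> 'e)"

definition is_chart :: "'m topology \<Rightarrow> ('m, 'e::euclidean_space) chart \<Rightarrow> bool" where
  "is_chart X c \<longleftrightarrow> openin X (fst c) \<and>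
     (\<exists>V. open V \<and> homeomorphic_map (subtopology X (fst c)) (top_of_set V) (snd c))"

definition chart_inv :: "('m, 'e::euclidean_space) chart \<Rightarrow> 'e \<Rightarrow> 'm" where
  "chart_inv c = inv_into (fst c) (snd c)"

definition transition ::
    "('m, 'e::euclidean_space) chart \<Rightarrow> ('m, 'e) chart \<Rightarrow> 'e \<Rightarrow> 'e" where
  "transition c d = snd d \<circ> chart_inv c"

text \<open>A smooth manifold of dimension \<open>DIM('e)\<close>. The smooth structure is given by a smooth
  atlas \<open>A\<close>, which need not be maximal.\<close>

definition smooth_manifold ::
    "'m topology \<Rightarrow> ('m, 'e::euclidean_space) chart set \<Rightarrow> bool" where
  "smooth_manifold X A \<longleftrightarrow>
     Hausdorff_space X \<and> second_countable X \<and>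
     (\<forall>c\<in>A. is_chart X c) \<and> (\<Union>c\<in>A. fst c) = topspace X \<and>
     (\<forall>c\<in>A. \<forall>d\<in>A. smooth_on (snd c ` (fst c \<inter> fst d)) (transition c d))"

text \<open>A tangent vector at \<open>x\<close> is the family of its coordinate vectors in all charts of \<open>A\<close>
  around \<open>x\<close> (and \<open>0\<close> at other indices), the coordinate vectors being related by the
  derivatives of the transition maps.\<close>

type_synonym ('m, 'e) tangent_vector = "('m, 'e) chart \<Rightarrow> 'e"

definition tangent_space ::
    "('m, 'e::euclidean_space) chart set \<Rightarrow> 'm \<Rightarrow> ('m, 'e) tangent_vector set" where
  "tangent_space A x = {v.
     (\<forall>c. \<not> (c \<in> A \<and> x \<in> fst c) \<longrightarrow> v c = 0) \<and>
     (\<forall>c\<in>A. \<forall>d\<in>A. x \<in> fst c \<inter> fst d \<longrightarrow>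
        v d = frechet_derivative (transition c d) (at (snd c x)) (v c))}"

text \<open>The tangent vector at \<open>x\<close> with coordinate vector \<open>u\<close> in the chart \<open>c\<close>.\<close>

definition tangent_of_coords ::
    "('m, 'e::euclidean_space) chart set \<Rightarrow> ('m, 'e) chart \<Rightarrow> 'm \<Rightarrow> 'e \<Rightarrow> ('m, 'e) tangent_vector"
  where
  "tangent_of_coords A c x u = (\<lambda>d. if d \<in> A \<and> x \<in> fst d
     then frechet_derivative (transition c d) (at (snd c x)) u else 0)"

definition inner_product_on :: "'v::real_vector set \<Rightarrow> ('v \<Rightarrow> 'v \<Rightarrow> real) \<Rightarrow> bool" where
  "inner_product_on V B \<longleftrightarrow>
     (\<forall>u\<in>V. \<forall>v\<in>V. \<forall>w\<in>V. B (u + v) w = B u w + B v w) \<and>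
     (\<forall>a. \<forall>u\<in>V. \<forall>v\<in>V. B (a *\<^sub>R u) v = a * B u v) \<and>
     (\<forall>u\<in>V. \<forall>v\<in>V. B u v = B v u) \<and>
     (\<forall>u\<in>V. u \<noteq> 0 \<longrightarrow> 0 < B u u)"

definition riemannian_metric ::
    "'m topology \<Rightarrow> ('m, 'e::euclidean_space) chart set \<Rightarrow>
     ('m \<Rightarrow> ('m, 'e) tangent_vector \<Rightarrow> ('m, 'e) tangent_vector \<Rightarrow> real) \<Rightarrow> bool" where
  "riemannian_metric X A g \<longleftrightarrow>
     (\<forall>x\<in>topspace X. inner_product_on (tangent_space A x) (g x)) \<and>
     (\<forall>c\<in>A. \<forall>u v. smooth_on (snd c ` fst c)
        (\<lambda>y. g (chart_inv c y) (tangent_of_coords A c (chart_inv c y) u)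
                                (tangent_of_coords A c (chart_inv c y) v)))"


section \<open>Double forms on a vector space\<close>

text \<open>Here \<open>V\<close> is a linear subspace of the ambient type. Alternating \<open>p\<close>-forms on \<open>V\<close> take
  lists of \<open>p\<close> vectors of \<open>V\<close> as arguments and are extended by \<open>0\<close> to all other lists, so that
  equality of forms is equality of functions.\<close>

definition alternating_forms :: "'v::real_vector set \<Rightarrow> nat \<Rightarrow> ('v list \<Rightarrow> real) set" where
  "alternating_forms V p = {\<theta>.
     (\<forall>xs. \<not> (length xs = p \<and> set xs \<subseteq> V) \<longrightarrow> \<theta> xs = 0) \<and>
     (\<forall>xs. length xs = p \<and> set xs \<subseteq> V \<longrightarrow>
        (\<forall>i<p. \<forall>u\<in>V. \<forall>v\<in>V. \<forall>a b.
           \<theta> (xs[i := a *\<^sub>R u + b *\<^sub>R v]) = a * \<theta> (xs[i := u]) + b * \<theta> (xs[i := v])) \<and>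
        (\<forall>i<p. \<forall>j<p. i \<noteq> j \<and> xs ! i = xs ! j \<longrightarrow> \<theta> xs = 0))}"

type_synonym 'v dform = "'v list \<Rightarrow> 'v list \<Rightarrow> real"

definition form_tensor :: "('v list \<Rightarrow> real) \<Rightarrow> ('v list \<Rightarrow> real) \<Rightarrow> 'v dform" where
  "form_tensor \<theta> \<eta> = (\<lambda>xs ys. \<theta> xs * \<eta> ys)"

text \<open>The tensor product of the space of alternating \<open>p\<close>-forms with itself, realised as a space
  of functions \<open>\<omega>(x\<^sub>1,\<dots>,x\<^sub>p; y\<^sub>1,\<dots>,y\<^sub>p)\<close>.\<close>

definition double_forms :: "'v::real_vector set \<Rightarrow> nat \<Rightarrow> 'v dform set" where
  "double_forms V p =
     span {form_tensor \<theta> \<eta> | \<theta> \<eta>. \<theta> \<in> alternating_forms V p \<and> \<eta> \<in> alternating_forms V p}"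

text \<open>Exterior product of a \<open>p\<close>-form and a \<open>q\<close>-form, normalised such that
  \<open>(\<theta> \<and> \<eta>)(x, y) = \<theta>(x) \<eta>(y) - \<theta>(y) \<eta>(x)\<close> for 1-forms.\<close>

definition wedge :: "nat \<Rightarrow> nat \<Rightarrow> ('v list \<Rightarrow> real) \<Rightarrow> ('v list \<Rightarrow> real) \<Rightarrow> 'v list \<Rightarrow> real" where
  "wedge p q \<theta> \<eta> = (\<lambda>xs. if length xs = p + q then
     (\<Sum>\<sigma> | \<sigma> permutes {..<p + q}. of_int (sign \<sigma>) *
        \<theta> (take p (permute_list \<sigma> xs)) * \<eta> (drop p (permute_list \<sigma> xs)))
     / (fact p * fact q) else 0)"

text \<open>Exterior (Kulkarni-Nomizu) product of a double form of degree \<open>p\<close> and one of degree \<open>q\<close>: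
  the bilinear extension of the product of decomposable double forms
  (see \<open>dform_prod_tensor\<close> and \<open>dform_prod_bilinear\<close>).\<close>

definition dform_prod :: "nat \<Rightarrow> nat \<Rightarrow> 'v dform \<Rightarrow> 'v dform \<Rightarrow> 'v dform" where
  "dform_prod p q \<alpha> \<beta> = (\<lambda>xs ys. if length xs = p + q \<and> length ys = p + q then
     (\<Sum>\<sigma> | \<sigma> permutes {..<p + q}. \<Sum>\<tau> | \<tau> permutes {..<p + q}.
        of_int (sign \<sigma>) * of_int (sign \<tau>) *
        \<alpha> (take p (permute_list \<sigma> xs)) (take p (permute_list \<tau> ys)) *
        \<beta> (drop p (permute_list \<sigma> xs)) (drop p (permute_list \<tau> ys)))
     / (fact p * fact q)\<^sup>2 else 0)"

lemma dform_prod_tensor: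
  "dform_prod p q (form_tensor \<theta>1 \<theta>2) (form_tensor \<theta>3 \<theta>4) =
   form_tensor (wedge p q \<theta>1 \<theta>3) (wedge p q \<theta>2 \<theta>4)"
  by (simp add: dform_prod_def form_tensor_def wedge_def fun_eq_iff power2_eq_square
      sum_product mult_ac)

lemma dform_prod_bilinear:
  fixes \<alpha> \<alpha>' \<beta> \<beta>' :: "'v dform"
  shows "dform_prod p q (a *\<^sub>R \<alpha> + b *\<^sub>R \<alpha>') \<beta> =
           a *\<^sub>R dform_prod p q \<alpha> \<beta> + b *\<^sub>R dform_prod p q \<alpha>' \<beta>"
    and "dform_prod p q \<alpha> (a *\<^sub>R \<beta> + b *\<^sub>R \<beta>') =
           a *\<^sub>R dform_prod p q \<alpha> \<beta> + b *\<^sub>R dform_prod p q \<alpha> \<beta>'"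
  by (simp_all add: dform_prod_def scaleR_fun_def fun_eq_iff sum_distrib_left
      sum.distrib[symmetric] add_divide_distrib[symmetric] algebra_simps)

text \<open>An inner product \<open>B\<close> on \<open>V\<close> as a double form of degree 1, and its powers.\<close>

definition metric_form :: "'v set \<Rightarrow> ('v \<Rightarrow> 'v \<Rightarrow> real) \<Rightarrow> 'v dform" where
  "metric_form V B = (\<lambda>xs ys.
     if length xs = 1 \<and> length ys = 1 \<and> set xs \<subseteq> V \<and> set ys \<subseteq> V then B (hd xs) (hd ys) else 0)"

primrec metric_power :: "'v set \<Rightarrow> ('v \<Rightarrow> 'v \<Rightarrow> real) \<Rightarrow> nat \<Rightarrow> 'v dform" where
  "metric_power V B 0 = (\<lambda>xs ys. if xs = [] \<and> ys = [] then 1 else 0)"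
| "metric_power V B (Suc i) = dform_prod 1 i (metric_form V B) (metric_power V B i)"

definition orthonormal_basis :: "'v::real_vector set \<Rightarrow> ('v \<Rightarrow> 'v \<Rightarrow> real) \<Rightarrow> 'v set \<Rightarrow> bool" where
  "orthonormal_basis V B E \<longleftrightarrow> finite E \<and> E \<subseteq> V \<and> span E = V \<and>
     (\<forall>e\<in>E. \<forall>f\<in>E. B e f = (if e = f then 1 else 0))"

text \<open>Ricci contraction, computed in some orthonormal basis (the result does not depend on it).
  It vanishes on double forms of degree 0, as these are \<open>0\<close> on nonempty lists.\<close>

definition ricci_contraction ::
    "'v::real_vector set \<Rightarrow> ('v \<Rightarrow> 'v \<Rightarrow> real) \<Rightarrow> 'v dform \<Rightarrow> 'v dform" where
  "ricci_contraction V B \<omega> =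
     (\<lambda>xs ys. \<Sum>e\<in>(SOME E. orthonormal_basis V B E). \<omega> (e # xs) (e # ys))"

definition trace_free_forms ::
    "'v::real_vector set \<Rightarrow> ('v \<Rightarrow> 'v \<Rightarrow> real) \<Rightarrow> nat \<Rightarrow> 'v dform set" where
  "trace_free_forms V B p = {\<omega> \<in> double_forms V p. ricci_contraction V B \<omega> = 0}"


section \<open>Bundles of double forms on a Riemannian manifold\<close>

text \<open>Fibres over \<open>x\<close> of the bundles \<open>D\<^sup>p\<^sup>,\<^sup>p\<close> and \<open>E\<^sup>p\<^sup>,\<^sup>p\<close>, and multiplication by
  \<open>g\<^sup>i\<close> on the fibre of \<open>D\<^sup>q\<^sup>,\<^sup>q\<close>.\<close>

definition D_fibre ::
    "('m, 'e::euclidean_space) chart set \<Rightarrow> nat \<Rightarrow> 'm \<Rightarrow> ('m, 'e) tangent_vector dform set" where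
  "D_fibre A p x = double_forms (tangent_space A x) p"

definition E_fibre ::
    "('m, 'e::euclidean_space) chart set \<Rightarrow>
     ('m \<Rightarrow> ('m, 'e) tangent_vector \<Rightarrow> ('m, 'e) tangent_vector \<Rightarrow> real) \<Rightarrow>
     nat \<Rightarrow> 'm \<Rightarrow> ('m, 'e) tangent_vector dform set" where
  "E_fibre A g p x = trace_free_forms (tangent_space A x) (g x) p"

definition g_mult ::
    "('m, 'e::euclidean_space) chart set \<Rightarrow>
     ('m \<Rightarrow> ('m, 'e) tangent_vector \<Rightarrow> ('m, 'e) tangent_vector \<Rightarrow> real) \<Rightarrow>
     'm \<Rightarrow> nat \<Rightarrow> nat \<Rightarrow> ('m, 'e) tangent_vector dform \<Rightarrow> ('m, 'e) tangent_vector dform" where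
  "g_mult A g x i q \<eta> = dform_prod i q (metric_power (tangent_space A x) (g x) i) \<eta>"

end

theory Submission
  imports Defs
begin

text \<open>Both assertions are statements about a single tangent space \<open>V\<close>, an inner product space of
dimension \<open>n\<close>, and they are the hard Lefschetz theorem for its double forms. Let \<open>L\<close> be the
multiplication by the metric and \<open>C\<close> the Ricci contraction; \<open>L\<close> raises the degree of a double
form by one and \<open>C\<close> lowers it by one. Everything rests on the commutation rule
\<open>C (L \<omega>) = L (C \<omega>) + (n - 2 k) \<omega>\<close> for \<open>\<omega>\<close> of degree \<open>k\<close> (\<open>contraction_L\<close>), that is, on the
fact that \<open>L\<close> and \<open>C\<close> generate a representation of \<open>sl\<^sub>2\<close>, and on the absence of nonzero double
forms of degree larger than \<open>n\<close> (\<open>double_forms_above_dim\<close>).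

Iterating the rule gives a formula for \<open>C L\<^sup>i\<^sup>+\<^sup>1\<close> (\<open>C_L_power\<close>). If \<open>\<omega>\<close> is trace free of degree
\<open>k\<close>, it reads \<open>C (L\<^sup>i\<^sup>+\<^sup>1 \<omega>) = (i + 1) (n - 2 k - i) L\<^sup>i \<omega>\<close>. As \<open>L\<^sup>i \<omega>\<close> vanishes for large \<open>i\<close>, it
vanishes for all \<open>i > n - 2 k\<close>, because the factor is nonzero there (\<open>L_power_primitive\<close>). For
\<open>i = p - k\<close> the condition \<open>i > n - 2 k\<close> is \<open>k > n - p\<close>: the second assertion concerns each
summand separately.

For the first assertion let \<open>m = 2 p - n > 0\<close> and let \<open>W\<close> be the image of \<open>L\<^sup>m\<close> in degree \<open>p\<close>. It
is invariant under \<open>L C\<close>, so that one can compute modulo \<open>W\<close>. By induction on \<open>j\<close>, every \<open>\<omega>\<close> of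
degree \<open>p\<close> with \<open>L\<^sup>j \<omega> = 0\<close> lies in \<open>W\<close>: the induction hypothesis makes \<open>\<omega>\<close> an eigenvector of
\<open>L C\<close> modulo \<open>W\<close> with a positive eigenvalue, whence \<open>L\<^sup>m C\<^sup>m \<omega>\<close>, which belongs to \<open>W\<close>, is
a positive multiple of \<open>\<omega>\<close> modulo \<open>W\<close> (\<open>L_power_onto\<close>).

The passage from products defined by sums over permutations to the operator \<open>L\<close> uses two facts:
the exterior product is associative (\<open>dform_prod_assoc\<close>), so that multiplication by \<open>g\<^sup>i\<close> is
\<open>L\<^sup>i\<close> (\<open>metric_power_mult\<close>), and the product with a double form of degree one can be expanded along
the arguments of that factor, like a determinant along a row (\<open>dform_prod_one_one\<close>).\<close>

section \<open>Raising and lowering operators on a graded vector space\<close>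

text \<open>A representation of \<open>sl\<^sub>2\<close> in which \<open>D k\<close> has weight \<open>n - 2 k\<close>, all weights lying between \<open>- n\<close>
and \<open>n\<close>. The operators are defined on the whole ambient space and do not depend on the degree,
so that their iterates are ordinary function powers.\<close>

locale lefschetz_operators =
  fixes L C :: "'a::real_vector \<Rightarrow> 'a" and D :: "nat \<Rightarrow> 'a set" and n :: nat
  assumes linear_L: "linear L" and linear_C: "linear C"
    and subspace_D: "subspace (D k)"
    and L_raises: "\<omega> \<in> D k \<Longrightarrow> L \<omega> \<in> D (Suc k)"
    and C_lowers: "\<omega> \<in> D (Suc k) \<Longrightarrow> C \<omega> \<in> D k"
    and C_bottom: "\<omega> \<in> D 0 \<Longrightarrow> C \<omega> = 0"
    and C_L: "\<omega> \<in> D k \<Longrightarrow> C (L \<omega>) = L (C \<omega>) + (real n - 2 * real k) *\<^sub>R \<omega>"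
    and D_above: "n < k \<Longrightarrow> D k = {0}"
begin

lemma linear_L_power: "linear (L ^^ i)"
proof (induction i)
  case (Suc i)
  then show ?case using linear_compose[OF Suc linear_L] by (simp add: o_def)
qed (simp add: linear_iff)

lemma L_power_raises: "\<omega> \<in> D k \<Longrightarrow> (L ^^ i) \<omega> \<in> D (k + i)"
  by (induction i) (auto intro: L_raises)

lemma C_power_lowers: "\<omega> \<in> D k \<Longrightarrow> i \<le> k \<Longrightarrow> (C ^^ i) \<omega> \<in> D (k - i)"
proof (induction i)
  case (Suc i)
  then have "(C ^^ i) \<omega> \<in> D (Suc (k - Suc i))"
    by (simp add: Suc_diff_Suc)
  then show ?case
    by (auto intro: C_lowers)
qed simp

lemma L_C_preserves: "\<omega> \<in> D k \<Longrightarrow> L (C \<omega>) \<in> D k"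
  by (cases k) (auto intro: L_raises C_lowers simp: C_bottom linear_0[OF linear_L] subspace_0[OF subspace_D])

text \<open>Moving \<open>C\<close> through \<open>i + 1\<close> factors \<open>L\<close> produces the numbers \<open>n - 2 (k + j)\<close> for \<open>j \<le> i\<close>, whose
sum is \<open>(i + 1) (n - 2 k - i)\<close>.\<close>

lemma C_L_power:
  assumes "\<omega> \<in> D k"
  shows "C ((L ^^ Suc i) \<omega>) =
    (L ^^ Suc i) (C \<omega>) + ((real i + 1) * (real n - 2 * real k - real i)) *\<^sub>R (L ^^ i) \<omega>"
proof (induction i)
  case 0
  show ?case using C_L[OF assms] by simp
next
  case (Suc i)
  have "C ((L ^^ Suc (Suc i)) \<omega>) =
      L (C ((L ^^ Suc i) \<omega>)) + (real n - 2 * real (k + Suc i)) *\<^sub>R (L ^^ Suc i) \<omega>"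
    using C_L[OF L_power_raises[OF assms], of "Suc i"] by simp
  also have "\<dots> = (L ^^ Suc (Suc i)) (C \<omega>) +
      ((real i + 1) * (real n - 2 * real k - real i) + (real n - 2 * real (k + Suc i))) *\<^sub>R
        (L ^^ Suc i) \<omega>"
    unfolding Suc by (simp add: linear_add[OF linear_L] linear_scale[OF linear_L] scaleR_add_left)
  also have "(real i + 1) * (real n - 2 * real k - real i) + (real n - 2 * real (k + Suc i)) =
      (real (Suc i) + 1) * (real n - 2 * real k - real (Suc i))"
    by (simp add: algebra_simps)
  finally show ?case .
qed

text \<open>The same rule after one more application of \<open>L\<close>. This form makes sense for \<open>i = 0\<close> too, and it
compares \<open>L\<^sup>i\<^sup>+\<^sup>1 C\<close> with the operator \<open>L C\<close>.\<close>

lemma L_C_L_power: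
  assumes "\<omega> \<in> D k"
  shows "L (C ((L ^^ i) \<omega>)) =
    (L ^^ Suc i) (C \<omega>) + (real i * (real n - 2 * real k - real i + 1)) *\<^sub>R (L ^^ i) \<omega>"
proof (cases i)
  case (Suc j)
  show ?thesis
    unfolding Suc C_L_power[OF assms]
    by (simp add: linear_add[OF linear_L] linear_scale[OF linear_L] diff_diff_eq add.commute)
qed simp

lemma L_power_above: "\<omega> \<in> D k \<Longrightarrow> n < k + i \<Longrightarrow> (L ^^ i) \<omega> = 0"
  using L_power_raises D_above by blast

text \<open>Descending induction from a power of \<open>L\<close> that leaves the range of degrees: if \<open>L\<^sup>m\<^sup>+\<^sup>1 \<omega> = 0\<close>,
applying \<open>C\<close> gives \<open>(m + 1) (n - 2 k - m) L\<^sup>m \<omega> = 0\<close>, and the factor is nonzero above \<open>n - 2 k\<close>.\<close>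

theorem L_power_primitive:
  assumes "\<omega> \<in> D k" and "C \<omega> = 0" and "n < i + 2 * k"
  shows "(L ^^ i) \<omega> = 0"
proof -
  \<comment> \<open>\<open>L\<^sup>i\<^sup>+\<^sup>n\<^sup>+\<^sup>1 \<omega>\<close> has degree larger than \<open>n\<close>, which starts the descent.\<close>
  have "i \<le> i + Suc n" by simp
  then show ?thesis using assms(3)
  proof (induction rule: inc_induct)
    case base
    show ?case using assms(1) by (rule L_power_above) simp
  next
    case (step m)
    have "0 = C ((L ^^ Suc m) \<omega>)"
      using step by (simp add: linear_0[OF linear_C])
    also have "\<dots> = ((real m + 1) * (real n - 2 * real k - real m)) *\<^sub>R (L ^^ m) \<omega>"
      unfolding C_L_power[OF assms(1)] assms(2) by (simp add: linear_0[OF linear_L_power] del: funpow.simps)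
    finally show ?case using step(4) by auto
  qed
qed

text \<open>Elements \<open>\<omega>\<close> of degree \<open>p\<close> are treated by induction on the power of \<open>L\<close> that kills them, modulo
the image \<open>W\<close> of \<open>L\<^sup>m\<close>, where \<open>m = 2 p - n\<close>. Division by the scalars \<open>\<mu>\<close> with
\<open>L\<^sup>m C\<^sup>m \<omega> - \<mu> \<omega> \<in> W\<close> is what gives the result; they are positive because \<open>m\<close> is.\<close>

theorem L_power_onto:
  assumes "p \<le> n" and "n < 2 * p"
  shows "D p = (L ^^ (2 * p - n)) ` D (n - p)"
proof
  show "(L ^^ (2 * p - n)) ` D (n - p) \<subseteq> D p"
    using L_power_raises[of _ "n - p" "2 * p - n"] assms by auto
next
  define m where "m = 2 * p - n"
  define W where "W = (L ^^ m) ` D (n - p)"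
  have m: "0 < m" "m \<le> p" "p - m = n - p" "real m = 2 * real p - real n"
    using assms by (auto simp: m_def)
  have W: "subspace W"
    unfolding W_def by (intro linear_subspace_image linear_L_power subspace_D)
  have W_LC: "L (C w) \<in> W" if "w \<in> W" for w
  proof -
    from that obtain \<eta> where \<eta>: "\<eta> \<in> D (n - p)" "w = (L ^^ m) \<eta>"
      by (auto simp: W_def)
    have "(L ^^ Suc m) (C \<eta>) = (L ^^ m) (L (C \<eta>))"
      by (simp add: funpow_swap1)
    then have "(L ^^ Suc m) (C \<eta>) \<in> W"
      unfolding W_def using L_C_preserves[OF \<eta>(1)] by (simp del: funpow.simps)
    then show ?thesis
      unfolding \<eta>(2) L_C_L_power[OF \<eta>(1)]
      using subspace_add[OF W] subspace_scale[OF W] that \<eta>(2) by blast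
  qed
  have *: "\<omega> \<in> W" if "\<omega> \<in> D p" "(L ^^ j) \<omega> = 0" for \<omega> j
    using that
  proof (induction j arbitrary: \<omega>)
    case 0
    then show ?case by (simp add: subspace_0[OF W])
  next
    case (Suc j)
    define \<kappa> where "\<kappa> = (real j + 1) * (real m + real j)"
    have "\<kappa> > 0" using m by (simp add: \<kappa>_def add_pos_nonneg)
    have "(L ^^ Suc j) (C \<omega>) = \<kappa> *\<^sub>R (L ^^ j) \<omega>"
    proof -
      have "0 = (L ^^ Suc j) (C \<omega>) + ((real j + 1) * (real n - 2 * real p - real j)) *\<^sub>R (L ^^ j) \<omega>"
        using C_L_power[OF Suc.prems(1), of j] Suc.prems(2)
        by (simp add: linear_0[OF linear_C] del: funpow.simps)
      moreover have "(real j + 1) * (real n - 2 * real p - real j) = - \<kappa>"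
        by (simp add: \<kappa>_def m(4) algebra_simps)
      ultimately show ?thesis by simp
    qed
    then have "(L ^^ j) (L (C \<omega>) - \<kappa> *\<^sub>R \<omega>) = 0"
      by (simp add: linear_diff[OF linear_L_power] linear_scale[OF linear_L_power] funpow_swap1)
    \<comment> \<open>Modulo \<open>W\<close>, the vector \<open>\<omega>\<close> is an eigenvector of \<open>L C\<close> with eigenvalue \<open>\<kappa>\<close>.\<close>
    then have eig: "L (C \<omega>) - \<kappa> *\<^sub>R \<omega> \<in> W"
      by (intro Suc.IH subspace_diff[OF subspace_D] subspace_scale[OF subspace_D] L_C_preserves Suc.prems)
    \<comment> \<open>Consequently \<open>L\<^sup>i C\<^sup>i\<close> multiplies \<open>\<omega>\<close> by
      \<open>\<mu> = \<Prod>\<^sub>l\<^sub><\<^sub>i (\<kappa> + l (m - 1 - l))\<close> modulo \<open>W\<close>.\<close>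
    have "\<exists>\<mu>>0. (L ^^ i) ((C ^^ i) \<omega>) - \<mu> *\<^sub>R \<omega> \<in> W" if "i \<le> m" for i
      using that
    proof (induction i)
      case 0
      show ?case using subspace_0[OF W] by (intro exI[of _ 1]) simp
    next
      case (Suc i)
      then obtain \<mu> where \<mu>: "\<mu> > 0" "(L ^^ i) ((C ^^ i) \<omega>) - \<mu> *\<^sub>R \<omega> \<in> W" by auto
      define w where "w = (L ^^ i) ((C ^^ i) \<omega>) - \<mu> *\<^sub>R \<omega>"
      define \<nu> where "\<nu> = real i * (real m - 1 - real i)"
      have "\<nu> \<ge> 0" unfolding \<nu>_def using Suc.prems by (cases "i = 0") auto
      have LiCi: "(L ^^ i) ((C ^^ i) \<omega>) = w + \<mu> *\<^sub>R \<omega>" by (simp add: w_def)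
      have mem: "(C ^^ i) \<omega> \<in> D (p - i)"
        using Suc.prems m(2) by (intro C_power_lowers \<open>\<omega> \<in> D p\<close>) simp
      have ri: "real (p - i) = real p - real i" using Suc.prems m(2) by simp
      have "(L ^^ Suc i) ((C ^^ Suc i) \<omega>) = L (C (w + \<mu> *\<^sub>R \<omega>)) + \<nu> *\<^sub>R (w + \<mu> *\<^sub>R \<omega>)"
      proof -
        have "real i * (real n - 2 * real (p - i) - real i + 1) = - \<nu>"
          unfolding ri by (simp add: \<nu>_def m(4) algebra_simps)
        then show ?thesis
          using L_C_L_power[OF mem, of i] unfolding LiCi by simp
      qed
      also have "\<dots> - (\<mu> * (\<kappa> + \<nu>)) *\<^sub>R \<omega> =
          L (C w) + \<mu> *\<^sub>R (L (C \<omega>) - \<kappa> *\<^sub>R \<omega>) + \<nu> *\<^sub>R w"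
        by (simp add: linear_add[OF linear_L] linear_scale[OF linear_L] linear_add[OF linear_C]
            linear_scale[OF linear_C] algebra_simps)
      also have "\<dots> \<in> W"
        using \<mu>(2) by (intro subspace_add[OF W] subspace_scale[OF W] W_LC eig) (simp_all add: w_def)
      finally show ?case
        using \<mu>(1) \<open>\<kappa> > 0\<close> \<open>\<nu> \<ge> 0\<close> by (intro exI[of _ "\<mu> * (\<kappa> + \<nu>)"]) simp
    qed
    then obtain \<mu> where \<mu>: "\<mu> > 0" "(L ^^ m) ((C ^^ m) \<omega>) - \<mu> *\<^sub>R \<omega> \<in> W" by blast
    have "(L ^^ m) ((C ^^ m) \<omega>) \<in> W"
      unfolding W_def using C_power_lowers[OF Suc.prems(1) m(2)] m(3) by simp
    from subspace_diff[OF W this \<mu>(2)] have "\<mu> *\<^sub>R \<omega> \<in> W" by simp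
    from subspace_scale[OF W this, of "1 / \<mu>"] show ?case using \<mu>(1) by simp
  qed
  show "D p \<subseteq> (L ^^ (2 * p - n)) ` D (n - p)"
    using *[OF _ L_power_above[of _ p "Suc n"]] by (auto simp: W_def m_def)
qed

end

section \<open>Alternating sums over permutations\<close>

lemma take_drop_permute_list_initial:
  assumes "\<rho> permutes {..<p}" and "p \<le> length zs"
  shows "take p (permute_list \<rho> zs) = permute_list \<rho> (take p zs)"
    and "drop p (permute_list \<rho> zs) = drop p zs"
proof -
  have \<rho>: "\<rho> permutes {..<length zs}" "\<rho> permutes {..<length (take p zs)}"
    using assms by (auto intro: permutes_subset)
  have "\<rho> i < p" if "i < p" for i
    using permutes_in_image[OF assms(1)] that by auto
  then show "take p (permute_list \<rho> zs) = permute_list \<rho> (take p zs)"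
    using assms \<rho> by (intro nth_equalityI) (auto simp: permute_list_nth)
  have "\<rho> (p + i) = p + i" for i
    using assms(1) by (simp add: permutes_not_in)
  then show "drop p (permute_list \<rho> zs) = drop p zs"
    using assms \<rho> by (intro nth_equalityI) (auto simp: permute_list_nth)
qed

text \<open>A permutation of \<open>q\<close> indices acts on the last \<open>q\<close> entries of a list through its conjugate by the
translation by \<open>p\<close>.\<close>

lemma take_drop_permute_list_shift:
  assumes "\<rho> permutes {..<q}" and "length zs = p + q"
  defines "\<rho>' \<equiv> map_permutation {..<q} ((+) p) \<rho>"
  shows "\<rho>' permutes {..<p + q}" and "sign \<rho>' = sign \<rho>"
    and "take p (permute_list \<rho>' zs) = take p zs"
    and "drop p (permute_list \<rho>' zs) = permute_list \<rho> (drop p zs)"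
proof -
  have "bij_betw ((+) p) {..<q} {p..<p + q}"
    by (rule bij_betwI[of _ _ _ "\<lambda>i. i - p"]) auto
  then have perm: "\<rho>' permutes {p..<p + q}"
    unfolding \<rho>'_def by (rule map_permutation_permutes) fact
  then show \<rho>': "\<rho>' permutes {..<p + q}"
    by (rule permutes_subset) auto
  show "sign \<rho>' = sign \<rho>"
    unfolding \<rho>'_def using assms by (intro sign_map_permutation) auto
  have "\<rho>' i = i" if "i < p" for i
    using perm that by (simp add: permutes_not_in)
  then show "take p (permute_list \<rho>' zs) = take p zs"
    using assms(2) \<rho>' by (intro nth_equalityI) (auto simp: permute_list_nth)
  have "\<rho>' (p + i) = p + \<rho> i" if "i < q" for i
    unfolding \<rho>'_def by (rule map_permutation_apply) (use that in auto)
  moreover have "\<rho> i < q" if "i < q" for i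
    using permutes_in_image[OF assms(1)] that by auto
  moreover have "\<rho> permutes {..<length (drop p zs)}" using assms by simp
  ultimately show "drop p (permute_list \<rho>' zs) = permute_list \<rho> (drop p zs)"
    using assms(2) \<rho>' by (intro nth_equalityI) (auto simp: permute_list_nth)
qed

text \<open>The sum that underlies both the exterior product of forms and the product of double forms. The
products of double forms are two nested alternations, one in each group of arguments, and the
lemmas below let them be treated one at a time.\<close>

definition alternation :: "nat \<Rightarrow> ('v list \<Rightarrow> real) \<Rightarrow> 'v list \<Rightarrow> real" where
  "alternation N F xs =
     (\<Sum>\<sigma> | \<sigma> permutes {..<N}. of_int (sign \<sigma>) * F (permute_list \<sigma> xs))"

lemma alternation_cong:
  assumes "\<And>zs. length zs = length xs \<Longrightarrow> set zs = set xs \<Longrightarrow> F zs = G zs" and "length xs = N"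
  shows "alternation N F xs = alternation N G xs"
  unfolding alternation_def using assms by (intro sum.cong) auto

lemma alternation_scale: "alternation N (\<lambda>zs. a * F zs) xs = a * alternation N F xs"
  by (simp add: alternation_def sum_distrib_left mult_ac)

lemma alternation_scale_right: "alternation N (\<lambda>zs. F zs * a) xs = alternation N F xs * a"
  by (simp add: alternation_def sum_distrib_right mult.assoc)

lemma alternation_divide: "alternation N (\<lambda>zs. F zs / a) xs = alternation N F xs / a"
  by (simp add: alternation_def sum_divide_distrib)

lemma alternation_sum: "alternation N (\<lambda>zs. \<Sum>i\<in>I. F i zs) xs = (\<Sum>i\<in>I. alternation N (F i) xs)"
  unfolding alternation_def by (subst sum.swap) (simp add: sum_distrib_left)

lemma alternation_commute:
  "alternation N (\<lambda>zs. alternation M (\<lambda>ws. F zs ws) ys) xs =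
   alternation M (\<lambda>ws. alternation N (\<lambda>zs. F zs ws) xs) ys"
  unfolding alternation_def sum_distrib_left by (subst sum.swap) (simp add: mult_ac)

text \<open>Reindexing the sum by \<open>\<sigma> \<mapsto> \<sigma> \<circ> \<rho>\<close>.\<close>

lemma alternation_compose:
  assumes "\<rho> permutes {..<N}" and "length xs = N"
  shows "alternation N (\<lambda>zs. of_int (sign \<rho>) * F (permute_list \<rho> zs)) xs = alternation N F xs"
proof -
  have sgn: "sign (\<sigma> \<circ> \<tau>) = sign \<sigma> * sign \<tau>" if "\<sigma> permutes {..<N}" "\<tau> permutes {..<N}" for \<sigma> \<tau>
    using that by (intro sign_compose permutes_imp_permutation[of "{..<N}"]) auto
  have "alternation N F xs = (\<Sum>\<sigma> | \<sigma> permutes {..<N}. of_int (sign (\<sigma> \<circ> \<rho>)) * F (permute_list (\<sigma> \<circ> \<rho>) xs))"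
    unfolding alternation_def by (rule sum_permutations_compose_right) fact
  also have "\<dots> = alternation N (\<lambda>zs. of_int (sign \<rho>) * F (permute_list \<rho> zs)) xs"
    unfolding alternation_def using assms
    by (intro sum.cong) (auto simp: sgn permute_list_compose)
  finally show ?thesis by simp
qed

lemma alternation_permute_list:
  assumes "\<rho> permutes {..<N}" and "length xs = N"
  shows "alternation N F (permute_list \<rho> xs) = of_int (sign \<rho>) * alternation N F xs"
proof -
  have sgn: "sign (\<sigma> \<circ> \<tau>) = sign \<sigma> * sign \<tau>" if "\<sigma> permutes {..<N}" "\<tau> permutes {..<N}" for \<sigma> \<tau>
    using that by (intro sign_compose permutes_imp_permutation[of "{..<N}"]) auto
  have "alternation N F xs = (\<Sum>\<sigma> | \<sigma> permutes {..<N}. of_int (sign (\<rho> \<circ> \<sigma>)) * F (permute_list (\<rho> \<circ> \<sigma>) xs))"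
    unfolding alternation_def by (rule setum_permutations_compose_left) fact
  also have "\<dots> = of_int (sign \<rho>) * alternation N F (permute_list \<rho> xs)"
    unfolding alternation_def sum_distrib_left using assms
    by (intro sum.cong) (auto simp: sgn permute_list_compose)
  finally show ?thesis
    by (simp flip: mult.assoc of_int_mult)
qed

text \<open>A permutation of the first \<open>p\<close> entries can be absorbed into the outer sum, so that each of the
\<open>p!\<close> terms of the inner alternation contributes the same.\<close>

lemma alternation_take:
  assumes "length xs = p + q"
  shows "alternation (p + q) (\<lambda>zs. alternation p (\<lambda>us. F us (drop p zs)) (take p zs)) xs =
    fact p * alternation (p + q) (\<lambda>zs. F (take p zs) (drop p zs)) xs"
proof -
  have "alternation (p + q) (\<lambda>zs. alternation p (\<lambda>us. F us (drop p zs)) (take p zs)) xs =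
    (\<Sum>\<rho> | \<rho> permutes {..<p}. alternation (p + q)
       (\<lambda>zs. of_int (sign \<rho>) * F (permute_list \<rho> (take p zs)) (drop p zs)) xs)"
    unfolding alternation_def[of p] by (rule alternation_sum)
  also have "\<dots> = (\<Sum>\<rho> | \<rho> permutes {..<p}. alternation (p + q) (\<lambda>zs. F (take p zs) (drop p zs)) xs)"
  proof (intro sum.cong refl)
    fix \<rho> assume "\<rho> \<in> {\<rho>. \<rho> permutes {..<p}}"
    then have \<rho>: "\<rho> permutes {..<p}" "\<rho> permutes {..<p + q}"
      by (auto intro: permutes_subset)
    show "alternation (p + q)
       (\<lambda>zs. of_int (sign \<rho>) * F (permute_list \<rho> (take p zs)) (drop p zs)) xs =
       alternation (p + q) (\<lambda>zs. F (take p zs) (drop p zs)) xs"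
      unfolding alternation_compose[OF \<rho>(2) assms, symmetric, of "\<lambda>zs. F (take p zs) (drop p zs)"]
      using assms by (intro alternation_cong) (simp_all add: take_drop_permute_list_initial[OF \<rho>(1)])
  qed
  finally show ?thesis by (simp add: card_permutations)
qed

lemma alternation_drop:
  assumes "length xs = p + q"
  shows "alternation (p + q) (\<lambda>zs. alternation q (\<lambda>us. F (take p zs) us) (drop p zs)) xs =
    fact q * alternation (p + q) (\<lambda>zs. F (take p zs) (drop p zs)) xs"
proof -
  have "alternation (p + q) (\<lambda>zs. alternation q (\<lambda>us. F (take p zs) us) (drop p zs)) xs =
    (\<Sum>\<rho> | \<rho> permutes {..<q}. alternation (p + q)
       (\<lambda>zs. of_int (sign \<rho>) * F (take p zs) (permute_list \<rho> (drop p zs))) xs)"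
    unfolding alternation_def[of q] by (rule alternation_sum)
  also have "\<dots> = (\<Sum>\<rho> | \<rho> permutes {..<q}. alternation (p + q) (\<lambda>zs. F (take p zs) (drop p zs)) xs)"
  proof (intro sum.cong refl)
    fix \<rho> assume "\<rho> \<in> {\<rho>. \<rho> permutes {..<q}}"
    then have \<rho>: "\<rho> permutes {..<q}" by simp
    note shift = take_drop_permute_list_shift[OF \<rho>]
    show "alternation (p + q)
       (\<lambda>zs. of_int (sign \<rho>) * F (take p zs) (permute_list \<rho> (drop p zs))) xs =
       alternation (p + q) (\<lambda>zs. F (take p zs) (drop p zs)) xs"
      unfolding alternation_compose[OF shift(1)[OF assms] assms, symmetric, of "\<lambda>zs. F (take p zs) (drop p zs)"]
      using assms by (intro alternation_cong) (simp_all add: shift)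
  qed
  finally show ?thesis by (simp add: card_permutations)
qed

lemma wedge_alternation:
  "wedge p q \<theta> \<eta> xs = (if length xs = p + q
     then alternation (p + q) (\<lambda>zs. \<theta> (take p zs) * \<eta> (drop p zs)) xs / (fact p * fact q) else 0)"
  by (simp add: wedge_def alternation_def mult_ac)

lemma dform_prod_alternation:
  "dform_prod p q \<alpha> \<beta> xs ys = (if length xs = p + q \<and> length ys = p + q
     then alternation (p + q) (\<lambda>zs. alternation (p + q)
         (\<lambda>ws. \<alpha> (take p zs) (take p ws) * \<beta> (drop p zs) (drop p ws)) ys) xs / (fact p * fact q)\<^sup>2
     else 0)"
  by (simp add: dform_prod_def alternation_def sum_distrib_left mult_ac)

text \<open>Both sides equal the alternation in both groups of arguments of
\<open>\<alpha> \<otimes> \<beta> \<otimes> \<gamma>\<close>, divided by \<open>(p! q! r!)\<^sup>2\<close>; the factorials of the inner alternations cancel against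
the normalisation of the outer product.\<close>

lemma dform_prod_assoc:
  "dform_prod (p + q) r (dform_prod p q \<alpha> \<beta>) \<gamma> = dform_prod p (q + r) \<alpha> (dform_prod q r \<beta> \<gamma>)"
proof (intro ext)
  fix xs ys :: "'a list"
  show "dform_prod (p + q) r (dform_prod p q \<alpha> \<beta>) \<gamma> xs ys =
      dform_prod p (q + r) \<alpha> (dform_prod q r \<beta> \<gamma>) xs ys"
  proof (cases "length xs = p + q + r \<and> length ys = p + q + r")
    case True
    then have len: "length xs = (p + q) + r" "length ys = (p + q) + r"
      "length xs = p + (q + r)" "length ys = p + (q + r)" by auto
    define T where "T = alternation (p + q + r) (\<lambda>zs. alternation (p + q + r) (\<lambda>ws.
        \<alpha> (take p zs) (take p ws) * \<beta> (take q (drop p zs)) (take q (drop p ws)) *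
        \<gamma> (drop (p + q) zs) (drop (p + q) ws)) ys) xs"
    define H where "H u v z w = \<alpha> (take p u) (take p v) * \<beta> (drop p u) (drop p v) * \<gamma> z w" for u v z w
    define K where "K a b z w = \<alpha> a b * (\<beta> (take q z) (take q w) * \<gamma> (drop q z) (drop q w))" for a b z w
    \<comment> \<open>An inner alternation in the first group of arguments has to pass the outer one in the
      second group before it can be absorbed into its own outer alternation.\<close>
    have swap1: "alternation (p + q + r) (\<lambda>ws. alternation (p + q) (\<lambda>u. alternation (p + q)
          (\<lambda>v. H u v (drop (p + q) zs) (drop (p + q) ws)) (take (p + q) ws)) (take (p + q) zs)) ys =
        alternation (p + q) (\<lambda>u. alternation (p + q + r) (\<lambda>ws. alternation (p + q)
          (\<lambda>v. H u v (drop (p + q) zs) (drop (p + q) ws)) (take (p + q) ws)) ys) (take (p + q) zs)" for zs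
      by (rule alternation_commute)
    have swap2: "alternation (p + (q + r)) (\<lambda>ws. alternation (q + r) (\<lambda>z. alternation (q + r)
          (\<lambda>w. K (take p zs) (take p ws) z w) (drop p ws)) (drop p zs)) ys =
        alternation (q + r) (\<lambda>z. alternation (p + (q + r)) (\<lambda>ws. alternation (q + r)
          (\<lambda>w. K (take p zs) (take p ws) z w) (drop p ws)) ys) (drop p zs)" for zs
      by (rule alternation_commute)
    have "alternation (p + q + r) (\<lambda>zs. alternation (p + q + r) (\<lambda>ws.
          dform_prod p q \<alpha> \<beta> (take (p + q) zs) (take (p + q) ws) * \<gamma> (drop (p + q) zs) (drop (p + q) ws)) ys) xs
       = alternation (p + q + r) (\<lambda>zs. alternation (p + q + r) (\<lambda>ws.
          alternation (p + q) (\<lambda>u. alternation (p + q) (\<lambda>v. H u v (drop (p + q) zs) (drop (p + q) ws))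
            (take (p + q) ws)) (take (p + q) zs) / (fact p * fact q)\<^sup>2) ys) xs"
      using len
      by (intro alternation_cong)
        (simp_all add: dform_prod_alternation H_def alternation_scale_right)
    also have "\<dots> = alternation (p + q + r) (\<lambda>zs. alternation (p + q) (\<lambda>u. alternation (p + q + r) (\<lambda>ws.
          alternation (p + q) (\<lambda>v. H u v (drop (p + q) zs) (drop (p + q) ws)) (take (p + q) ws)) ys)
            (take (p + q) zs)) xs / (fact p * fact q)\<^sup>2"
      unfolding alternation_divide swap1 ..
    also have "\<dots> = (fact (p + q))\<^sup>2 * T / (fact p * fact q)\<^sup>2"
      unfolding alternation_take[OF len(2), of "\<lambda>v w. H _ v _ w"] alternation_scale
        alternation_take[OF len(1), of "\<lambda>u z. alternation (p + q + r) (\<lambda>ws. H u (take (p + q) ws) z (drop (p + q) ws)) ys"]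
      by (simp add: T_def H_def power2_eq_square drop_take)
    finally have l: "dform_prod (p + q) r (dform_prod p q \<alpha> \<beta>) \<gamma> xs ys = T / (fact p * fact q * fact r)\<^sup>2"
      using True by (simp add: dform_prod_alternation[of "p + q" r] field_simps)
    have "alternation (p + (q + r)) (\<lambda>zs. alternation (p + (q + r)) (\<lambda>ws.
          \<alpha> (take p zs) (take p ws) * dform_prod q r \<beta> \<gamma> (drop p zs) (drop p ws)) ys) xs
       = alternation (p + (q + r)) (\<lambda>zs. alternation (p + (q + r)) (\<lambda>ws.
          alternation (q + r) (\<lambda>z. alternation (q + r) (\<lambda>w. K (take p zs) (take p ws) z w)
            (drop p ws)) (drop p zs) / (fact q * fact r)\<^sup>2) ys) xs"
      using len by (intro alternation_cong) (simp_all add: dform_prod_alternation K_def alternation_scale)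
    also have "\<dots> = alternation (p + (q + r)) (\<lambda>zs. alternation (q + r) (\<lambda>z. alternation (p + (q + r)) (\<lambda>ws.
          alternation (q + r) (\<lambda>w. K (take p zs) (take p ws) z w) (drop p ws)) ys)
            (drop p zs)) xs / (fact q * fact r)\<^sup>2"
      unfolding alternation_divide swap2 ..
    also have "\<dots> = (fact (q + r))\<^sup>2 * T / (fact q * fact r)\<^sup>2"
      unfolding alternation_drop[OF len(4), of "\<lambda>v w. K _ v _ w"] alternation_scale
        alternation_drop[OF len(3), of "\<lambda>a z. alternation (p + (q + r)) (\<lambda>ws. K a (take p ws) z (drop p ws)) ys"]
      by (simp add: T_def K_def power2_eq_square add_ac mult.assoc)
    finally have "dform_prod p (q + r) \<alpha> (dform_prod q r \<beta> \<gamma>) xs ys = T / (fact p * fact q * fact r)\<^sup>2"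
      using True by (simp add: dform_prod_alternation[of p "q + r"] field_simps)
    with l show ?thesis by simp
  qed (auto simp: dform_prod_def)
qed

section \<open>Alternating forms and double forms\<close>

lemma alternating_formsI:
  assumes "\<And>xs. \<not> (length xs = p \<and> set xs \<subseteq> V) \<Longrightarrow> \<theta> xs = 0"
    and "\<And>xs i u v a b. length xs = p \<Longrightarrow> set xs \<subseteq> V \<Longrightarrow> i < p \<Longrightarrow> u \<in> V \<Longrightarrow> v \<in> V \<Longrightarrow>
      \<theta> (xs[i := a *\<^sub>R u + b *\<^sub>R v]) = a * \<theta> (xs[i := u]) + b * \<theta> (xs[i := v])"
    and "\<And>xs i j. length xs = p \<Longrightarrow> set xs \<subseteq> V \<Longrightarrow> i < p \<Longrightarrow> j < p \<Longrightarrow> i \<noteq> j \<Longrightarrow> xs ! i = xs ! j \<Longrightarrow>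
      \<theta> xs = 0"
  shows "\<theta> \<in> alternating_forms V p"
  unfolding alternating_forms_def mem_Collect_eq
  by (intro conjI allI impI ballI; (elim conjE)?; (rule assms; assumption)?)

lemma alternating_formsD:
  assumes "\<theta> \<in> alternating_forms V p"
  shows alternating_outside: "\<not> (length xs = p \<and> set xs \<subseteq> V) \<Longrightarrow> \<theta> xs = 0"
    and alternating_linear: "length xs = p \<Longrightarrow> set xs \<subseteq> V \<Longrightarrow> i < p \<Longrightarrow> u \<in> V \<Longrightarrow> v \<in> V \<Longrightarrow>
      \<theta> (xs[i := a *\<^sub>R u + b *\<^sub>R v]) = a * \<theta> (xs[i := u]) + b * \<theta> (xs[i := v])"
    and alternating_repeated: "i < length xs \<Longrightarrow> j < length xs \<Longrightarrow> i \<noteq> j \<Longrightarrow> xs ! i = xs ! j \<Longrightarrow> \<theta> xs = 0"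
proof -
  have 1: "\<not> (length xs = p \<and> set xs \<subseteq> V) \<longrightarrow> \<theta> xs = 0" for xs
    using assms unfolding alternating_forms_def by simp
  have 2: "length xs = p \<and> set xs \<subseteq> V \<longrightarrow>
      (\<forall>i<p. \<forall>u\<in>V. \<forall>v\<in>V. \<forall>a b. \<theta> (xs[i := a *\<^sub>R u + b *\<^sub>R v]) = a * \<theta> (xs[i := u]) + b * \<theta> (xs[i := v]))"
    and 3: "length xs = p \<and> set xs \<subseteq> V \<longrightarrow> (\<forall>i<p. \<forall>j<p. i \<noteq> j \<and> xs ! i = xs ! j \<longrightarrow> \<theta> xs = 0)" for xs
    using assms unfolding alternating_forms_def mem_Collect_eq by simp_all
  show "\<not> (length xs = p \<and> set xs \<subseteq> V) \<Longrightarrow> \<theta> xs = 0"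
    using 1 by simp
  show "length xs = p \<Longrightarrow> set xs \<subseteq> V \<Longrightarrow> i < p \<Longrightarrow> u \<in> V \<Longrightarrow> v \<in> V \<Longrightarrow>
      \<theta> (xs[i := a *\<^sub>R u + b *\<^sub>R v]) = a * \<theta> (xs[i := u]) + b * \<theta> (xs[i := v])"
    using 2[of xs] by simp
  show "i < length xs \<Longrightarrow> j < length xs \<Longrightarrow> i \<noteq> j \<Longrightarrow> xs ! i = xs ! j \<Longrightarrow> \<theta> xs = 0"
    using 1[of xs] 3[of xs] by blast
qed

lemma subspace_alternating_forms: "subspace (alternating_forms V p)"
proof (rule subspaceI)
  show "0 \<in> alternating_forms V p"
    by (rule alternating_formsI) simp_all
next
  fix \<theta> \<eta> assume \<theta>: "\<theta> \<in> alternating_forms V p" and \<eta>: "\<eta> \<in> alternating_forms V p"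
  show "\<theta> + \<eta> \<in> alternating_forms V p"
    by (rule alternating_formsI)
      (auto simp: alternating_outside[OF \<theta>] alternating_outside[OF \<eta>] alternating_linear[OF \<theta>]
        alternating_linear[OF \<eta>] algebra_simps,
      metis alternating_repeated[OF \<theta>] alternating_repeated[OF \<eta>] add_0)
next
  fix \<theta> c assume \<theta>: "\<theta> \<in> alternating_forms V p"
  show "c *\<^sub>R \<theta> \<in> alternating_forms V p"
    by (rule alternating_formsI)
      (auto simp: scaleR_fun_def alternating_outside[OF \<theta>] alternating_linear[OF \<theta>] algebra_simps
        intro: alternating_repeated[OF \<theta>])
qed

lemma alternating_sum:
  assumes "\<theta> \<in> alternating_forms V p" and V: "subspace V"
    and xs: "length xs = p" "set xs \<subseteq> V" "i < p" and "finite E" "E \<subseteq> V"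
  shows "\<theta> (xs[i := \<Sum>e\<in>E. c e *\<^sub>R e]) = (\<Sum>e\<in>E. c e * \<theta> (xs[i := e]))"
  using \<open>finite E\<close> \<open>E \<subseteq> V\<close>
proof (induction E)
  case empty
  show ?case
    using alternating_linear[OF assms(1) xs, of 0 0 0 0] subspace_0[OF V] by simp
next
  case (insert e E)
  then have "(\<Sum>e\<in>E. c e *\<^sub>R e) \<in> V"
    by (intro subspace_sum[OF V] subspace_scale[OF V]) auto
  with insert show ?case
    using alternating_linear[OF assms(1) xs, of e "\<Sum>e\<in>E. c e *\<^sub>R e" "c e" 1] by simp
qed

text \<open>Polarisation: the form vanishes when both slots are filled with the sum of the two entries.\<close>

lemma alternating_swap:
  assumes \<theta>: "\<theta> \<in> alternating_forms V p" and V: "subspace V"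
    and ij: "i < length xs" "j < length xs" "i \<noteq> j"
  shows "\<theta> (xs[i := xs ! j, j := xs ! i]) = - \<theta> xs"
proof (cases "length xs = p \<and> set xs \<subseteq> V")
  case False
  then have "\<not> (length (xs[i := xs ! j, j := xs ! i]) = p \<and> set (xs[i := xs ! j, j := xs ! i]) \<subseteq> V)"
    using ij by simp
  with False show ?thesis
    using alternating_outside[OF \<theta>] by simp
next
  case True
  define f where "f u v = \<theta> (xs[i := u, j := v])" for u v
  let ?u = "xs ! i" and ?v = "xs ! j"
  have uv: "?u \<in> V" "?v \<in> V" "?u + ?v \<in> V"
    using True ij by (auto intro!: subspace_add[OF V])
  have set: "set (xs[k := w]) \<subseteq> V" if "w \<in> V" for w k
    using set_update_subset_insert[of xs k w] True that by auto
  have f2: "f u (?u + ?v) = f u ?u + f u ?v" if "u \<in> V" for u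
    unfolding f_def
    using alternating_linear[OF \<theta>, of "xs[i := u]" j ?u ?v 1 1] True ij uv set[OF that] by simp
  have f1: "f (?u + ?v) w = f ?u w + f ?v w" if "w \<in> V" for w
    unfolding f_def list_update_swap[OF ij(3)]
    using alternating_linear[OF \<theta>, of "xs[j := w]" i ?u ?v 1 1] True ij uv set[OF that]
    by (simp del: list_update_id)
  have f0: "f u u = 0" for u
    unfolding f_def by (rule alternating_repeated[OF \<theta>, of i _ j]) (use ij in auto)
  have "0 = f (?u + ?v) (?u + ?v)" by (simp add: f0)
  also have "\<dots> = f ?u ?v + f ?v ?u"
    unfolding f1[OF uv(3)] f2[OF uv(1)] f2[OF uv(2)] by (simp add: f0)
  also have "f ?u ?v = \<theta> xs"
    using ij by (simp add: f_def)
  finally show ?thesis by (simp add: f_def)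
qed

lemma permute_list_transpose:
  assumes "i < length xs" "j < length xs"
  shows "permute_list (Transposition.transpose i j) xs = xs[i := xs ! j, j := xs ! i]"
  using assms by (intro nth_equalityI) (auto simp: permute_list_def nth_list_update transpose_def)

lemma alternating_permute_list:
  assumes \<theta>: "\<theta> \<in> alternating_forms V p" and V: "subspace V"
    and "\<sigma> permutes {..<length xs}"
  shows "\<theta> (permute_list \<sigma> xs) = of_int (sign \<sigma>) * \<theta> xs"
proof -
  have "\<theta> (permute_list \<sigma> ys) = of_int (sign \<sigma>) * \<theta> ys" if "length ys = length xs" for ys
    using \<open>\<sigma> permutes {..<length xs}\<close> finite_lessThan that
  proof (induction arbitrary: ys rule: permutes_induct)
    case (swap a b \<rho>)
    have "sign (Transposition.transpose a b \<circ> \<rho>) = - sign \<rho>"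
      using swap permutes_imp_permutation[OF finite_lessThan swap.hyps(4)]
      by (simp add: sign_compose sign_swap_id permutation_swap_id)
    then show ?case
      using swap alternating_swap[OF \<theta> V, of a ys b]
      by (simp add: permute_list_compose permute_list_transpose del: comp_apply)
  qed simp
  then show ?thesis by simp
qed

text \<open>More than \<open>dim V\<close> vectors are linearly dependent. Expanding one of them in terms of the others
leaves only lists with a repeated entry.\<close>

lemma alternating_above_dim:
  assumes \<theta>: "\<theta> \<in> alternating_forms V p" and V: "subspace V"
    and "finite E" "V \<subseteq> span E" "card E < p"
  shows "\<theta> = 0"
proof
  fix xs
  show "\<theta> xs = 0 xs"
  proof (cases "length xs = p \<and> set xs \<subseteq> V \<and> distinct xs")
    case False
    then consider "\<not> (length xs = p \<and> set xs \<subseteq> V)" | "\<not> distinct xs" by blast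
    then show ?thesis
      using alternating_outside[OF \<theta>] alternating_repeated[OF \<theta>] by cases (auto simp: distinct_conv_nth)
  next
    case True
    then have "card (set xs) = p" by (simp add: distinct_card)
    then have "dependent (set xs)"
      using independent_span_bound[of E "set xs"] True assms(3-5) by force
    then obtain x where x: "x \<in> set xs" "x \<in> span (set xs - {x})"
      unfolding dependent_def by blast
    then obtain i where i: "i < p" "xs ! i = x"
      using True by (auto simp: in_set_conv_nth)
    obtain c where c: "x = (\<Sum>e\<in>set xs - {x}. c e *\<^sub>R e)"
      using x(2) by (auto simp: span_finite)
    have 0: "\<theta> (xs[i := e]) = 0" if "e \<in> set xs - {x}" for e
    proof -
      from that obtain j where "j < p" "xs ! j = e" "j \<noteq> i"
        using i True by (auto simp: in_set_conv_nth)
      then show ?thesis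
        using i True by (intro alternating_repeated[OF \<theta>, of i _ j]) auto
    qed
    have "\<theta> xs = \<theta> (xs[i := x])"
      using i by auto
    also have "\<dots> = (\<Sum>e\<in>set xs - {x}. c e * \<theta> (xs[i := e]))"
      by (subst c, rule alternating_sum[OF \<theta> V]) (use True i in auto)
    also have "\<dots> = 0"
      using 0 by (intro sum.neutral) simp
    finally show ?thesis by simp
  qed
qed

lemma permute_list_update:
  assumes "\<sigma> permutes {..<length xs}" and "i < length xs"
  shows "permute_list \<sigma> (xs[i := u]) = (permute_list \<sigma> xs)[inv \<sigma> i := u]"
proof (rule nth_equalityI)
  fix j assume "j < length (permute_list \<sigma> (xs[i := u]))"
  then have "j < length xs" "\<sigma> j < length xs"
    using permutes_in_image[OF assms(1), of j] by auto
  then show "permute_list \<sigma> (xs[i := u]) ! j = (permute_list \<sigma> xs)[inv \<sigma> i := u] ! j"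
    using assms permutes_inv_eq[OF assms(1)]
    by (auto simp: permute_list_nth nth_list_update permutes_inverses[OF assms(1)])
qed simp

text \<open>Linearity holds for each summand of the alternation. If two entries agree, the transposition of
their positions fixes the list but reverses the sign of the alternation.\<close>

lemma wedge_alternating:
  assumes \<theta>: "\<theta> \<in> alternating_forms V p" and \<eta>: "\<eta> \<in> alternating_forms V q"
  shows "wedge p q \<theta> \<eta> \<in> alternating_forms V (p + q)"
proof -
  let ?F = "\<lambda>zs. \<theta> (take p zs) * \<eta> (drop p zs)"
  have outside: "wedge p q \<theta> \<eta> xs = 0" if "\<not> (length xs = p + q \<and> set xs \<subseteq> V)" for xs
  proof -
    have "?F zs = 0" if "length zs = p + q" "\<not> set zs \<subseteq> V" for zs
    proof -
      from that have "\<not> set (take p zs) \<subseteq> V \<or> \<not> set (drop p zs) \<subseteq> V"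
        using set_append[of "take p zs" "drop p zs"] by auto
      then show ?thesis
        using alternating_outside[OF \<theta>] alternating_outside[OF \<eta>] by auto
    qed
    then have "alternation (p + q) ?F xs = 0" if "length xs = p + q" "\<not> set xs \<subseteq> V"
      unfolding alternation_def using that by (intro sum.neutral) auto
    then show ?thesis using that by (auto simp: wedge_alternation)
  qed
  have lin: "alternation (p + q) ?F (xs[i := a *\<^sub>R u + b *\<^sub>R v]) =
      a * alternation (p + q) ?F (xs[i := u]) + b * alternation (p + q) ?F (xs[i := v])"
    if xs: "length xs = p + q" "set xs \<subseteq> V" "i < p + q" and uv: "u \<in> V" "v \<in> V" for xs i a b u v
  proof -
    have F: "?F (zs[j := a *\<^sub>R u + b *\<^sub>R v]) = a * ?F (zs[j := u]) + b * ?F (zs[j := v])"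
      if zs: "length zs = p + q" "set zs \<subseteq> V" "j < p + q" for zs j
    proof -
      have sets: "set (take p zs) \<subseteq> V" "set (drop p zs) \<subseteq> V"
        using zs set_take_subset[of p zs] set_drop_subset[of p zs] by auto
      show ?thesis
      proof (cases "j < p")
        case True
        then show ?thesis
          using alternating_linear[OF \<theta>, of "take p zs" j u v a b] zs sets uv
          by (simp add: take_update_swap algebra_simps)
      next
        case False
        then show ?thesis
          using alternating_linear[OF \<eta>, of "drop p zs" "j - p" u v a b] zs sets uv
          by (simp add: drop_update_swap take_update_cancel algebra_simps)
      qed
    qed
    have "?F (permute_list \<sigma> (xs[i := a *\<^sub>R u + b *\<^sub>R v])) =
        a * ?F (permute_list \<sigma> (xs[i := u])) + b * ?F (permute_list \<sigma> (xs[i := v]))"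
      if \<sigma>: "\<sigma> permutes {..<p + q}" for \<sigma>
    proof -
      have "inv \<sigma> i < p + q"
        using permutes_in_image[OF permutes_inv[OF \<sigma>]] xs(3) by auto
      then show ?thesis
        using F[of "permute_list \<sigma> xs" "inv \<sigma> i"] \<sigma> xs by (simp add: permute_list_update)
    qed
    then show ?thesis
      unfolding alternation_def sum_distrib_left sum.distrib[symmetric]
      by (intro sum.cong) (auto simp: algebra_simps)
  qed
  have rep: "alternation (p + q) ?F xs = 0"
    if xs: "length xs = p + q" and ij: "i < p + q" "j < p + q" "i \<noteq> j" "xs ! i = xs ! j" for xs i j
  proof -
    have "permute_list (Transposition.transpose i j) xs = xs"
      using xs ij list_update_id[of xs i] list_update_id[of xs j] by (simp add: permute_list_transpose)
    moreover have "Transposition.transpose i j permutes {..<p + q}"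
      using ij by (intro permutes_swap_id) auto
    ultimately show ?thesis
      using alternation_permute_list[of "Transposition.transpose i j" "p + q" xs ?F] xs ij(3) by (simp add: sign_swap_id)
  qed
  show ?thesis
  proof (rule alternating_formsI)
    fix xs :: "'a list" assume "\<not> (length xs = p + q \<and> set xs \<subseteq> V)"
    then show "wedge p q \<theta> \<eta> xs = 0" by (rule outside)
  next
    fix xs :: "'a list" and i u v and a b :: real
    assume "length xs = p + q" "set xs \<subseteq> V" "i < p + q" "u \<in> V" "v \<in> V"
    then show "wedge p q \<theta> \<eta> (xs[i := a *\<^sub>R u + b *\<^sub>R v]) =
        a * wedge p q \<theta> \<eta> (xs[i := u]) + b * wedge p q \<theta> \<eta> (xs[i := v])"
      using lin[of xs i u v a b] by (simp add: wedge_alternation field_simps)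
  next
    fix xs :: "'a list" and i j
    assume "length xs = p + q" "i < p + q" "j < p + q" "i \<noteq> j" "xs ! i = xs ! j"
    then show "wedge p q \<theta> \<eta> xs = 0"
      using rep[of xs i j] by (simp add: wedge_alternation)
  qed
qed

lemma subspace_double_forms: "subspace (double_forms V p)"
  unfolding double_forms_def by (rule subspace_span)

lemma form_tensor_double_form:
  "\<theta> \<in> alternating_forms V p \<Longrightarrow> \<eta> \<in> alternating_forms V p \<Longrightarrow> form_tensor \<theta> \<eta> \<in> double_forms V p"
  unfolding double_forms_def by (rule span_base) blast

text \<open>The form in which the definition of double forms as a span of tensors is used throughout.\<close>

lemma linear_image_double_forms:
  assumes "linear f" and "subspace S"
    and "\<And>\<theta> \<eta>. \<theta> \<in> alternating_forms V p \<Longrightarrow> \<eta> \<in> alternating_forms V p \<Longrightarrow> f (form_tensor \<theta> \<eta>) \<in> S"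
    and "\<omega> \<in> double_forms V p"
  shows "f \<omega> \<in> S"
proof -
  have "double_forms V p \<subseteq> f -` S"
    unfolding double_forms_def
    using assms(3) by (intro span_minimal linear_subspace_vimage assms(1,2)) auto
  with assms(4) show ?thesis by blast
qed

text \<open>A double form is alternating in each of its two groups of arguments. This is all that is used of
a double form once it is evaluated on lists.\<close>

lemma double_forms_alternating:
  assumes "\<omega> \<in> double_forms V p"
  shows "\<omega> xs \<in> alternating_forms V p" and "(\<lambda>xs. \<omega> xs ys) \<in> alternating_forms V p"
proof -
  have 1: "linear (\<lambda>\<omega>::'a dform. \<omega> xs)" and 2: "linear (\<lambda>\<omega>::'a dform. (\<lambda>xs. \<omega> xs ys))"
    by (auto simp: linear_iff fun_eq_iff scaleR_fun_def)
  show "\<omega> xs \<in> alternating_forms V p"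
  proof (rule linear_image_double_forms[OF 1 subspace_alternating_forms _ assms])
    fix \<theta> \<eta> assume "\<theta> \<in> alternating_forms V p" "\<eta> \<in> alternating_forms V p"
    then show "form_tensor \<theta> \<eta> xs \<in> alternating_forms V p"
      using subspace_scale[OF subspace_alternating_forms, of \<eta> V p "\<theta> xs"]
      by (simp add: form_tensor_def scaleR_fun_def)
  qed
  show "(\<lambda>xs. \<omega> xs ys) \<in> alternating_forms V p"
  proof (rule linear_image_double_forms[OF 2 subspace_alternating_forms _ assms])
    fix \<theta> \<eta> assume "\<theta> \<in> alternating_forms V p" "\<eta> \<in> alternating_forms V p"
    then show "(\<lambda>xs. form_tensor \<theta> \<eta> xs ys) \<in> alternating_forms V p"
      using subspace_scale[OF subspace_alternating_forms, of \<theta> V p "\<eta> ys"]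
      by (simp add: form_tensor_def scaleR_fun_def mult.commute)
  qed
qed

lemma double_forms_outside:
  assumes "\<omega> \<in> double_forms V p"
    and "\<not> (length xs = p \<and> set xs \<subseteq> V \<and> length ys = p \<and> set ys \<subseteq> V)"
  shows "\<omega> xs ys = 0"
  using alternating_outside[OF double_forms_alternating(1)[OF assms(1)], of ys xs]
    alternating_outside[OF double_forms_alternating(2)[OF assms(1)], of xs ys] assms(2) by auto

lemma double_forms_above_dim:
  assumes "subspace V" "finite E" "V \<subseteq> span E" "card E < p"
  shows "double_forms V p = {0}"
proof -
  have "\<omega> = 0" if "\<omega> \<in> double_forms V p" for \<omega>
    using alternating_above_dim[OF double_forms_alternating(1)[OF that] assms] by (auto simp: fun_eq_iff)
  then show ?thesis
    using subspace_0[OF subspace_double_forms] by blast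
qed

lemma dform_prod_double_form:
  assumes "\<alpha> \<in> double_forms V p" and "\<beta> \<in> double_forms V q"
  shows "dform_prod p q \<alpha> \<beta> \<in> double_forms V (p + q)"
proof -
  have 1: "linear (\<lambda>\<alpha>. dform_prod p q \<alpha> \<beta>)" for \<beta> :: "'a dform"
    using dform_prod_bilinear(1)[of p q 1 _ 1 _ \<beta>] dform_prod_bilinear(1)[of p q _ _ 0 0 \<beta>]
    by (auto simp: linear_iff)
  have 2: "linear (dform_prod p q \<alpha>)" for \<alpha> :: "'a dform"
    using dform_prod_bilinear(2)[of p q \<alpha> 1 _ 1] dform_prod_bilinear(2)[of p q \<alpha> _ _ 0 0]
    by (auto simp: linear_iff)
  show ?thesis
    by (rule linear_image_double_forms[OF 1 subspace_double_forms _ assms(1)],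
        rule linear_image_double_forms[OF 2 subspace_double_forms _ assms(2)])
      (simp add: dform_prod_tensor form_tensor_double_form wedge_alternating)
qed

section \<open>Inner products and orthonormal bases\<close>

lemma inner_product_onD:
  assumes "inner_product_on V B"
  shows "u \<in> V \<Longrightarrow> v \<in> V \<Longrightarrow> w \<in> V \<Longrightarrow> B (u + v) w = B u w + B v w"
    and "u \<in> V \<Longrightarrow> w \<in> V \<Longrightarrow> B (a *\<^sub>R u) w = a * B u w"
    and "u \<in> V \<Longrightarrow> v \<in> V \<Longrightarrow> B u v = B v u"
    and "u \<in> V \<Longrightarrow> u \<noteq> 0 \<Longrightarrow> 0 < B u u"
  using assms by (simp_all add: inner_product_on_def)

lemma inner_product_on_sum:
  assumes B: "inner_product_on V B" and V: "subspace V" and "finite F" "F \<subseteq> V" "w \<in> V"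
  shows "B (\<Sum>e\<in>F. c e *\<^sub>R e) w = (\<Sum>e\<in>F. c e * B e w)"
  using assms(3,4)
proof (induction F)
  case empty
  show ?case using inner_product_onD(2)[OF B, of w w 0] assms(5) by simp
next
  case (insert e F)
  then have "(\<Sum>e\<in>F. c e *\<^sub>R e) \<in> V"
    by (intro subspace_sum[OF V] subspace_scale[OF V]) auto
  with insert show ?case
    using assms(5) by (simp add: inner_product_onD(1,2)[OF B] subspace_scale[OF V])
qed

text \<open>Gram-Schmidt orthogonalisation of a finite spanning set, one vector at a time.\<close>

lemma orthonormal_basis_exists:
  assumes B: "inner_product_on V B" and V: "subspace V" and "finite S" "V = span S"
  shows "\<exists>E. orthonormal_basis V B E"
proof -
  have "\<exists>E. finite E \<and> E \<subseteq> V \<and> span E = span T \<and> (\<forall>e\<in>E. \<forall>f\<in>E. B e f = (if e = f then 1 else 0))"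
    if "finite T" "T \<subseteq> V" for T
    using that
  proof (induction T)
    case empty
    show ?case by (intro exI[of _ "{}"]) simp
  next
    case (insert a T)
    then obtain E where E: "finite E" "E \<subseteq> V" "span E = span T"
      and ortho: "\<And>e f. e \<in> E \<Longrightarrow> f \<in> E \<Longrightarrow> B e f = (if e = f then 1 else 0)"
      by auto
    define s where "s = (\<Sum>e\<in>E. B a e *\<^sub>R e)"
    define b where "b = a + (- 1) *\<^sub>R s"
    have a: "a \<in> V" using insert.prems by simp
    have s: "s \<in> span E"
      unfolding s_def by (intro span_sum span_scale span_base)
    have "s \<in> V"
      unfolding s_def using E(2) by (intro subspace_sum[OF V] subspace_scale[OF V]) auto
    then have b: "b \<in> V"
      unfolding b_def by (intro subspace_add[OF V] subspace_scale[OF V] a)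
    have Bb: "B b f = 0" if "f \<in> E" for f
    proof -
      have f: "f \<in> V" using that E(2) by auto
      have "B s f = (\<Sum>e\<in>E. B a e * B e f)"
        unfolding s_def by (rule inner_product_on_sum[OF B V E(1,2) f])
      also have "\<dots> = (\<Sum>e\<in>E. if e = f then B a e else 0)"
        using that by (intro sum.cong) (auto simp: ortho)
      also have "\<dots> = B a f" using that E(1) by simp
      finally show ?thesis
        unfolding b_def using a f \<open>s \<in> V\<close> by (simp add: inner_product_onD(1,2)[OF B] subspace_scale[OF V] del: scaleR_minus_left scaleR_minus1_left)
    qed
    have span_b: "span (insert b E) = span (insert a T)"
    proof -
      have "span (insert b E) = span (insert a E)"
        using eq_span_insert_eq[of a b E] s by (simp add: b_def)
      also have "\<dots> = span (insert a T)"
        by (simp add: span_insert E(3))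
      finally show ?thesis .
    qed
    show ?case
    proof (cases "b = 0")
      case True
      then show ?thesis
        using E ortho span_b by (intro exI[of _ E]) (simp add: span_insert_0)
    next
      case False
      define r where "r = 1 / sqrt (B b b)"
      define c where "c = r *\<^sub>R b"
      have pos: "0 < B b b" using inner_product_onD(4)[OF B b False] .
      then have "r > 0" by (simp add: r_def)
      have c: "c \<in> V" unfolding c_def by (rule subspace_scale[OF V b])
      have Bc: "B c w = r * B b w" if "w \<in> V" for w
        unfolding c_def using b that by (rule inner_product_onD(2)[OF B])
      have cf: "B c f = 0" "B f c = 0" if "f \<in> E" for f
        using that E(2) Bc[of f] Bb[OF that] inner_product_onD(3)[OF B, of f c] c by auto
      have "B b c = r * B b b"
        using inner_product_onD(3)[OF B b c] Bc[OF b] by simp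
      then have "B c c = r * r * B b b"
        using Bc[OF c] by simp
      also have "\<dots> = 1"
        using pos by (simp add: r_def)
      finally have cc: "B c c = 1" .
      have "c \<notin> E" using cf(1)[of c] cc by auto
      have "span (insert c E) = span (insert b E)"
      proof -
        have "span {c} = span {b}"
          unfolding c_def using \<open>r > 0\<close> span_image_scale[of "{b}" "\<lambda>_. r"] by simp
        then show ?thesis
          using span_Un[of "{c}" E] span_Un[of "{b}" E] by simp
      qed
      with span_b E ortho c cf cc \<open>c \<notin> E\<close> show ?thesis
        by (intro exI[of _ "insert c E"]) auto
    qed
  qed
  from this[of S] assms(3,4) span_superset[of S] show ?thesis
    unfolding orthonormal_basis_def by auto
qed

section \<open>Multiplication by a double form of degree one\<close>

text \<open>The list \<open>xs\<close> without its entry at \<open>b\<close>, the first entry having moved to the vacant place.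
With this convention, bringing the entry at \<open>b\<close> to the front is a transposition. Its sign
is \<open>- 1\<close> for every \<open>b > 0\<close>, and there are no signs \<open>(- 1)\<^sup>b\<close> to keep track of.\<close>

definition pull_out :: "nat \<Rightarrow> 'v list \<Rightarrow> 'v list" where
  "pull_out b xs = tl (xs[0 := xs ! b, b := xs ! 0])"

definition pull_sign :: "nat \<Rightarrow> real" where
  "pull_sign b = (if b = 0 then 1 else - 1)"

lemma length_pull_out [simp]: "length (pull_out b xs) = length xs - 1"
  by (simp add: pull_out_def)

lemma pull_out_Cons_0 [simp]: "pull_out 0 (x # xs) = xs"
  by (simp add: pull_out_def)

lemma pull_out_Cons_Suc [simp]: "pull_out (Suc b) (x # xs) = xs[b := x]"
  by (simp add: pull_out_def)

lemma alternating_Cons_pull_out: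
  assumes "\<theta> \<in> alternating_forms V p" and "subspace V" and "b < length xs"
  shows "pull_sign b * \<theta> (e # pull_out b xs) = \<theta> (xs[b := e])"
proof (cases xs)
  case (Cons x us)
  show ?thesis
  proof (cases b)
    case 0
    then show ?thesis by (simp add: Cons pull_sign_def)
  next
    case (Suc c)
    with assms(3) Cons have c: "c < length us" by simp
    have "\<theta> ((x # us[c := e])[0 := (x # us[c := e]) ! Suc c, Suc c := (x # us[c := e]) ! 0]) = - \<theta> (x # us[c := e])"
      by (rule alternating_swap[OF assms(1,2)]) (use c in auto)
    with c show ?thesis by (simp add: Cons Suc pull_sign_def)
  qed
qed (use assms in simp)

text \<open>Every permutation of \<open>{0..k}\<close> is uniquely a permutation of \<open>{1..k}\<close> followed by a transposition
of \<open>0\<close> with some \<open>b\<close>. The first factor permutes the arguments of \<open>\<eta>\<close> and its sign cancels,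
which accounts for the factor \<open>k!\<close>; the second one selects the argument of \<open>\<phi>\<close>.\<close>

lemma alternation_one_form:
  assumes \<eta>: "\<eta> \<in> alternating_forms V k" and V: "subspace V" and xs: "length xs = Suc k"
  shows "alternation (Suc k) (\<lambda>zs. \<phi> (take 1 zs) * \<eta> (drop 1 zs)) xs =
    fact k * (\<Sum>b<Suc k. pull_sign b * \<phi> [xs ! b] * \<eta> (pull_out b xs))"
proof -
  let ?S = "{1..<Suc k}" and ?F = "\<lambda>zs. \<phi> (take 1 zs) * \<eta> (drop 1 zs)"
  have S: "{..<Suc k} = insert 0 ?S" by auto
  have summand: "of_int (sign (Transposition.transpose 0 b \<circ> q)) * ?F (permute_list (Transposition.transpose 0 b \<circ> q) xs) =
      pull_sign b * \<phi> [xs ! b] * \<eta> (pull_out b xs)"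
    if b: "b \<in> insert 0 ?S" and q: "q permutes ?S" for b q
  proof -
    define ys where "ys = permute_list (Transposition.transpose 0 b) xs"
    have ys: "length ys = Suc k" "ys = xs[0 := xs ! b, b := xs ! 0]"
      unfolding ys_def using b xs by (auto intro: permute_list_transpose)
    have hd: "ys ! 0 = xs ! b" and tl: "drop 1 ys = pull_out b xs"
      using xs by (cases "b = 0"; simp add: ys(2) pull_out_def drop_Suc)+
    have q': "q permutes {..<Suc k}"
      by (rule permutes_subset[OF q]) auto
    \<comment> \<open>the permutation of the arguments of \<open>\<eta>\<close> that \<open>q\<close> induces\<close>
    define r where "r = map_permutation ?S (\<lambda>i. i - 1) q"
    have "bij_betw (\<lambda>i. i - 1) ?S {..<k}"
      by (rule bij_betwI[of _ _ _ Suc]) auto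
    then have r: "r permutes {..<k}"
      unfolding r_def using q by (rule map_permutation_permutes)
    have sign_r: "sign r = sign q"
      unfolding r_def by (rule sign_map_permutation) (use q in \<open>auto simp: inj_on_def\<close>)
    have q_Suc: "q (Suc i) = Suc (r i)" if "i < k" for i
    proof -
      have "r (Suc i - 1) = q (Suc i) - 1"
        unfolding r_def by (rule map_permutation_apply) (use that in \<open>auto simp: inj_on_def\<close>)
      moreover have "q (Suc i) \<in> ?S"
        using that permutes_in_image[OF q] by auto
      ultimately show ?thesis by auto
    qed
    have "q 0 = 0"
      by (rule permutes_not_in[OF q]) simp
    then have t: "take 1 (permute_list q ys) = [xs ! b]"
      using ys(1) q' hd by (intro nth_equalityI) (auto simp: permute_list_nth)
    have r_less: "r i < k" if "i < k" for i
      using permutes_in_image[OF r] that by auto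
    have d: "drop 1 (permute_list q ys) = permute_list r (pull_out b xs)"
      using ys(1) q' r r_less q_Suc xs
      by (intro nth_equalityI) (auto simp: permute_list_nth simp flip: tl)
    have sgn: "sign (Transposition.transpose 0 b \<circ> q) = (if b = 0 then 1 else - 1) * sign q"
      using permutes_imp_permutation[OF _ q]
      by (simp add: sign_compose permutation_swap_id sign_swap_id)
    have q_ys: "permute_list (Transposition.transpose 0 b \<circ> q) xs = permute_list q ys"
      unfolding ys_def using q' xs by (simp add: permute_list_compose del: comp_apply)
    have "\<eta> (permute_list r (pull_out b xs)) = of_int (sign q) * \<eta> (pull_out b xs)"
      using alternating_permute_list[OF \<eta> V, of r "pull_out b xs"] r xs sign_r by simp
    then show ?thesis
      unfolding sgn q_ys t d by (simp add: pull_sign_def sign_def)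
  qed
  have "alternation (Suc k) ?F xs =
      (\<Sum>b\<in>insert 0 ?S. \<Sum>q | q permutes ?S. of_int (sign (Transposition.transpose 0 b \<circ> q)) *
         ?F (permute_list (Transposition.transpose 0 b \<circ> q) xs))"
    unfolding alternation_def S by (rule sum_over_permutations_insert) auto
  also have "\<dots> = (\<Sum>b\<in>insert 0 ?S. \<Sum>q | q permutes ?S. pull_sign b * \<phi> [xs ! b] * \<eta> (pull_out b xs))"
    by (intro sum.cong refl summand) auto
  also have "\<dots> = fact k * (\<Sum>b<Suc k. pull_sign b * \<phi> [xs ! b] * \<eta> (pull_out b xs))"
    unfolding S by (simp add: card_permutations sum_distrib_left del: insert_iff sum.insert)
  finally show ?thesis .
qed

text \<open>The product with a double form \<open>\<alpha>\<close> of degree one, expanded along the arguments of \<open>\<alpha>\<close>. The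
expression does not contain the degree of \<open>\<omega>\<close>, so that multiplication by \<open>\<alpha>\<close> becomes one linear
operator on all double forms.\<close>

definition one_one_mult :: "'v dform \<Rightarrow> 'v dform \<Rightarrow> 'v dform" where
  "one_one_mult \<alpha> \<omega> = (\<lambda>xs ys. \<Sum>a<length xs. \<Sum>b<length ys.
     pull_sign a * pull_sign b * \<alpha> [xs ! a] [ys ! b] * \<omega> (pull_out a xs) (pull_out b ys))"

lemma linear_one_one_mult: "linear (one_one_mult \<alpha>)"
  by (simp add: linear_iff one_one_mult_def fun_eq_iff scaleR_fun_def algebra_simps sum.distrib
      sum_distrib_left)

text \<open>The expansion of \<open>alternation_one_form\<close> is applied to the second group of arguments with the
first one held fixed, and then to the first group.\<close>

lemma dform_prod_one_one:
  assumes V: "subspace V" and \<omega>: "\<omega> \<in> double_forms V k"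
  shows "dform_prod 1 k \<alpha> \<omega> = one_one_mult \<alpha> \<omega>"
proof (intro ext)
  fix xs ys :: "'a list"
  show "dform_prod 1 k \<alpha> \<omega> xs ys = one_one_mult \<alpha> \<omega> xs ys"
  proof (cases "length xs = Suc k \<and> length ys = Suc k")
    case True
    note alt = double_forms_alternating[OF \<omega>]
    have "alternation (Suc k) (\<lambda>zs. alternation (Suc k)
        (\<lambda>ws. \<alpha> (take 1 zs) (take 1 ws) * \<omega> (drop 1 zs) (drop 1 ws)) ys) xs =
      alternation (Suc k) (\<lambda>zs. fact k * (\<Sum>b<Suc k. pull_sign b *
        (\<alpha> (take 1 zs) [ys ! b] * \<omega> (drop 1 zs) (pull_out b ys)))) xs"
      using True
      by (intro alternation_cong)
        (simp_all only: alternation_one_form[OF alt(1) V] mult.assoc)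
    also have "\<dots> = fact k * (\<Sum>b<Suc k. pull_sign b * alternation (Suc k) (\<lambda>zs.
        \<alpha> (take 1 zs) [ys ! b] * \<omega> (drop 1 zs) (pull_out b ys)) xs)"
      by (simp only: alternation_scale alternation_sum)
    also have "\<dots> = fact k * (\<Sum>b<Suc k. pull_sign b * (fact k * (\<Sum>a<Suc k. pull_sign a *
        \<alpha> [xs ! a] [ys ! b] * \<omega> (pull_out a xs) (pull_out b ys))))"
    proof -
      have "alternation (Suc k) (\<lambda>zs. \<alpha> (take 1 zs) [ys ! b] * \<omega> (drop 1 zs) (pull_out b ys)) xs =
          fact k * (\<Sum>a<Suc k. pull_sign a * \<alpha> [xs ! a] [ys ! b] * \<omega> (pull_out a xs) (pull_out b ys))" for b
        using True by (intro alternation_one_form[OF alt(2) V, where \<phi> = "\<lambda>u. \<alpha> u [ys ! b]"]) auto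
      then show ?thesis by simp
    qed
    also have "\<dots> = (fact k)\<^sup>2 * one_one_mult \<alpha> \<omega> xs ys"
    proof -
      have "one_one_mult \<alpha> \<omega> xs ys = (\<Sum>b<Suc k. \<Sum>a<Suc k.
          pull_sign a * pull_sign b * \<alpha> [xs ! a] [ys ! b] * \<omega> (pull_out a xs) (pull_out b ys))"
        using True by (simp only: one_one_mult_def) (rule sum.swap)
      then show ?thesis
        by (simp add: power2_eq_square sum_distrib_left mult_ac del: sum.lessThan_Suc)
    qed
    finally show ?thesis
      using True by (simp add: dform_prod_alternation)
  next
    case False
    have "\<omega> (pull_out a xs) (pull_out b ys) = 0" if "a < length xs" "b < length ys" for a b
      by (rule double_forms_outside[OF \<omega>]) (use that False in auto)
    then have "one_one_mult \<alpha> \<omega> xs ys = 0"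
      unfolding one_one_mult_def by (intro sum.neutral ballI) simp
    then show ?thesis
      using False by (auto simp: dform_prod_def)
  qed
qed

section \<open>The Ricci contraction and its commutator with the metric\<close>

text \<open>The Ricci contraction for a given set \<open>E\<close> in place of a chosen orthonormal basis.\<close>

definition contraction :: "'v set \<Rightarrow> 'v dform \<Rightarrow> 'v dform" where
  "contraction E \<omega> = (\<lambda>xs ys. \<Sum>e\<in>E. \<omega> (e # xs) (e # ys))"

lemma linear_contraction: "linear (contraction E)"
  by (simp add: linear_iff contraction_def fun_eq_iff scaleR_fun_def sum.distrib sum_distrib_left)

lemma sum_dform_apply:
  fixes F :: "'i \<Rightarrow> 'v dform"
  shows "(\<Sum>i\<in>I. F i) xs ys = (\<Sum>i\<in>I. F i xs ys)"
  by (induction I rule: infinite_finite_induct) simp_all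

lemma alternating_interior:
  assumes \<theta>: "\<theta> \<in> alternating_forms V (Suc p)" and "e \<in> V"
  shows "(\<lambda>xs. \<theta> (e # xs)) \<in> alternating_forms V p"
proof (rule alternating_formsI)
  fix xs :: "'a list" and i u v and a b :: real
  assume "length xs = p" "set xs \<subseteq> V" "i < p" "u \<in> V" "v \<in> V"
  then show "\<theta> (e # xs[i := a *\<^sub>R u + b *\<^sub>R v]) = a * \<theta> (e # xs[i := u]) + b * \<theta> (e # xs[i := v])"
    using alternating_linear[OF \<theta>, of "e # xs" "Suc i" u v a b] \<open>e \<in> V\<close> by simp
next
  fix xs :: "'a list" and i j
  assume "length xs = p" "i < p" "j < p" "i \<noteq> j" "xs ! i = xs ! j"
  then show "\<theta> (e # xs) = 0"
    by (intro alternating_repeated[OF \<theta>, of "Suc i" _ "Suc j"]) auto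
next
  fix xs assume "\<not> (length xs = p \<and> set xs \<subseteq> V)"
  then show "\<theta> (e # xs) = 0"
    by (intro alternating_outside[OF \<theta>]) auto
qed

lemma contraction_double_form:
  assumes "E \<subseteq> V" and "\<omega> \<in> double_forms V (Suc p)"
  shows "contraction E \<omega> \<in> double_forms V p"
proof (rule linear_image_double_forms[OF linear_contraction subspace_double_forms _ assms(2)])
  fix \<theta> \<eta> assume *: "\<theta> \<in> alternating_forms V (Suc p)" "\<eta> \<in> alternating_forms V (Suc p)"
  have "contraction E (form_tensor \<theta> \<eta>) =
      (\<Sum>e\<in>E. form_tensor (\<lambda>xs. \<theta> (e # xs)) (\<lambda>ys. \<eta> (e # ys)))"
    by (intro ext) (simp add: sum_dform_apply contraction_def form_tensor_def)
  also have "\<dots> \<in> double_forms V p"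
    using * assms(1)
    by (intro subspace_sum[OF subspace_double_forms] form_tensor_double_form alternating_interior) auto
  finally show "contraction E (form_tensor \<theta> \<eta>) \<in> double_forms V p" .
qed

lemma contraction_degree_0: "\<omega> \<in> double_forms V 0 \<Longrightarrow> contraction E \<omega> = 0"
  by (auto simp: contraction_def fun_eq_iff intro!: sum.neutral double_forms_outside)

locale orthonormal_frame =
  fixes V :: "'v::real_vector set" and B :: "'v \<Rightarrow> 'v \<Rightarrow> real" and E :: "'v set"
  assumes inner: "inner_product_on V B" and basis: "orthonormal_basis V B E"
begin

lemma finite_E: "finite E" and E_subset: "E \<subseteq> V" and span_E: "span E = V"
  and B_E: "e \<in> E \<Longrightarrow> f \<in> E \<Longrightarrow> B e f = (if e = f then 1 else 0)"
  using basis unfolding orthonormal_basis_def by simp_all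

lemma subspace_V: "subspace V"
  using span_E subspace_span[of E] by simp

lemmas B_add = inner_product_onD(1)[OF inner]
  and B_scale = inner_product_onD(2)[OF inner]
  and B_sym = inner_product_onD(3)[OF inner]
  and B_sum = inner_product_on_sum[OF inner subspace_V]

lemma independent_E: "independent E"
proof
  assume "dependent E"
  then obtain c e where c: "(\<Sum>f\<in>E. c f *\<^sub>R f) = 0" and e: "e \<in> E" "c e \<noteq> 0"
    using dependent_finite[OF finite_E] by auto
  have eV: "e \<in> V" using e(1) E_subset by auto
  have "0 = B 0 e"
    using B_scale[OF eV eV, of 0] by simp
  also have "\<dots> = (\<Sum>f\<in>E. c f * B f e)"
    unfolding c[symmetric] by (rule B_sum[OF finite_E E_subset eV])
  also have "\<dots> = (\<Sum>f\<in>E. if f = e then c f else 0)"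
    using e by (intro sum.cong) (auto simp: B_E)
  also have "\<dots> = c e" using e finite_E by simp
  finally show False using e by simp
qed

lemma card_E:
  assumes "finite S" and "independent S" and "V = span S"
  shows "card E = card S"
  using independent_span_bound[of S E] independent_span_bound[of E S] independent_E assms
    finite_E span_E span_superset[of S] span_superset[of E] by auto

lemma expansion:
  assumes "v \<in> V"
  shows "v = (\<Sum>e\<in>E. B e v *\<^sub>R e)"
proof -
  obtain c where c: "v = (\<Sum>e\<in>E. c e *\<^sub>R e)"
    using assms span_finite[OF finite_E] span_E by auto
  have "B e v = c e" if "e \<in> E" for e
  proof -
    have "B e v = B v e" using that assms E_subset by (intro B_sym) auto
    also have "\<dots> = (\<Sum>f\<in>E. c f * B f e)"
      unfolding c by (rule B_sum) (use finite_E E_subset that in auto)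
    also have "\<dots> = (\<Sum>f\<in>E. if f = e then c f else 0)"
      using that by (intro sum.cong) (auto simp: B_E)
    also have "\<dots> = c e" using that finite_E by simp
    finally show ?thesis .
  qed
  then show ?thesis using c by simp
qed

lemma B_expansion:
  assumes "u \<in> V" "v \<in> V"
  shows "B u v = (\<Sum>e\<in>E. B e u * B e v)"
  using B_sum[OF finite_E E_subset assms(2), of "\<lambda>e. B e u"] expansion[OF assms(1)] by simp

text \<open>The metric is \<open>\<Sum>\<^sub>e B(e, \<cdot>) \<otimes> B(e, \<cdot>)\<close>, summed over an orthonormal basis.\<close>

lemma metric_form_double_form: "metric_form V B \<in> double_forms V 1"
proof -
  define \<phi> where "\<phi> e xs = (if length xs = 1 \<and> set xs \<subseteq> V then B e (hd xs) else 0)" for e and xs :: "'v list"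
  have "\<phi> e \<in> alternating_forms V 1" if "e \<in> V" for e
  proof (rule alternating_formsI)
    fix xs :: "'v list" and i :: nat and u v and a b :: real
    assume *: "length xs = 1" "i < 1" "u \<in> V" "v \<in> V"
    then have "a *\<^sub>R u + b *\<^sub>R v \<in> V"
      by (intro subspace_add[OF subspace_V] subspace_scale[OF subspace_V])
    with * that have "B e (a *\<^sub>R u + b *\<^sub>R v) = a * B e u + b * B e v"
      by (simp add: B_sym[OF that] B_add B_scale subspace_scale[OF subspace_V])
    moreover obtain x where "xs = [x]" using * by (auto simp: length_Suc_conv)
    ultimately show "\<phi> e (xs[i := a *\<^sub>R u + b *\<^sub>R v]) = a * \<phi> e (xs[i := u]) + b * \<phi> e (xs[i := v])"
      using * \<open>a *\<^sub>R u + b *\<^sub>R v \<in> V\<close> by (simp add: \<phi>_def)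
  qed (auto simp: \<phi>_def)
  then have "(\<Sum>e\<in>E. form_tensor (\<phi> e) (\<phi> e)) \<in> double_forms V 1"
    using E_subset by (intro subspace_sum[OF subspace_double_forms] form_tensor_double_form) auto
  moreover have "metric_form V B = (\<Sum>e\<in>E. form_tensor (\<phi> e) (\<phi> e))"
  proof (intro ext)
    fix xs ys :: "'v list"
    show "metric_form V B xs ys = (\<Sum>e\<in>E. form_tensor (\<phi> e) (\<phi> e)) xs ys"
    proof (cases "length xs = 1 \<and> length ys = 1 \<and> set xs \<subseteq> V \<and> set ys \<subseteq> V")
      case True
      then have "hd xs \<in> V" "hd ys \<in> V"
        by (auto simp: length_Suc_conv)
      with True show ?thesis
        by (simp add: sum_dform_apply form_tensor_def metric_form_def \<phi>_def B_expansion)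
    next
      case False
      then show ?thesis
        unfolding sum_dform_apply form_tensor_def metric_form_def \<phi>_def by (subst sum.neutral) auto
    qed
  qed
  ultimately show ?thesis by simp
qed

abbreviation "L \<equiv> one_one_mult (metric_form V B)"

lemma L_double_form: "\<omega> \<in> double_forms V k \<Longrightarrow> L \<omega> \<in> double_forms V (Suc k)"
  using dform_prod_double_form[OF metric_form_double_form, of \<omega> k]
  by (simp add: dform_prod_one_one[OF subspace_V, unfolded One_nat_def])

text \<open>Splitting off the leading arguments prepares the substitution \<open>x = y = e\<close> of the contraction.\<close>

lemma L_Cons:
  assumes "length us = k" "length vs = k"
  shows "L \<omega> (x # us) (y # vs) = metric_form V B [x] [y] * \<omega> us vs
    - (\<Sum>b<k. metric_form V B [x] [vs ! b] * \<omega> us (vs[b := y]))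
    - (\<Sum>a<k. metric_form V B [us ! a] [y] * \<omega> (us[a := x]) vs)
    + (\<Sum>a<k. \<Sum>b<k. metric_form V B [us ! a] [vs ! b] * \<omega> (us[a := x]) (vs[b := y]))"
  using assms
  by (simp add: one_one_mult_def sum.lessThan_Suc_shift pull_sign_def sum.distrib sum_negf
      sum_subtractf algebra_simps del: sum.lessThan_Suc)

text \<open>Put \<open>x = y = e\<close> in \<open>L_Cons\<close> and sum over the orthonormal basis. The first term gives \<open>n \<omega>\<close>. In the
second and third, \<open>\<Sum>\<^sub>e B(e, v) e = v\<close> puts back each of the \<open>k\<close> arguments \<open>v\<close> that had been
replaced, so each gives \<open>- k \<omega>\<close>. The last one is the product of the metric with the
contraction of \<open>\<omega>\<close>.\<close>

lemma contraction_L: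
  assumes \<omega>: "\<omega> \<in> double_forms V k"
  shows "contraction E (L \<omega>) = L (contraction E \<omega>) + (real (card E) - 2 * real k) *\<^sub>R \<omega>"
proof (intro ext)
  fix us vs :: "'v list"
  let ?rhs = "L (contraction E \<omega>) + (real (card E) - 2 * real k) *\<^sub>R \<omega>"
  note alt = double_forms_alternating[OF \<omega>]
  have "L (contraction E \<omega>) \<in> double_forms V k"
  proof (cases k)
    case 0
    then show ?thesis
      using \<omega> by (simp add: contraction_degree_0 linear_0[OF linear_one_one_mult] subspace_0[OF subspace_double_forms])
  next
    case (Suc j)
    then show ?thesis
      using \<omega> contraction_double_form[OF E_subset] L_double_form by auto
  qed
  then have rhs: "?rhs \<in> double_forms V k"
    using \<omega> by (intro subspace_add[OF subspace_double_forms] subspace_scale[OF subspace_double_forms])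
  have lhs: "contraction E (L \<omega>) \<in> double_forms V k"
    using \<omega> by (intro contraction_double_form E_subset L_double_form)
  show "contraction E (L \<omega>) us vs = ?rhs us vs"
  proof (cases "length us = k \<and> set us \<subseteq> V \<and> length vs = k \<and> set vs \<subseteq> V")
    case False
    then show ?thesis
      using double_forms_outside[OF lhs False] double_forms_outside[OF rhs False] by simp
  next
    case True
    then have len: "length us = k" "length vs = k" and sets: "set us \<subseteq> V" "set vs \<subseteq> V" by auto
    have mem: "us ! a \<in> V" "vs ! a \<in> V" if "a < k" for a
      using that len sets by auto
    have m: "metric_form V B [u] [v] = B u v" if "u \<in> V" "v \<in> V" for u v
      using that by (simp add: metric_form_def)
    have E: "e \<in> V" if "e \<in> E" for e using that E_subset by auto
    have 1: "(\<Sum>e\<in>E. metric_form V B [e] [e] * \<omega> us vs) = real (card E) * \<omega> us vs"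
      by (simp add: m E B_E)
    have 2: "(\<Sum>e\<in>E. \<Sum>b<k. metric_form V B [e] [vs ! b] * \<omega> us (vs[b := e])) = real k * \<omega> us vs"
    proof -
      have "(\<Sum>e\<in>E. metric_form V B [e] [vs ! b] * \<omega> us (vs[b := e])) = \<omega> us vs" if "b < k" for b
      proof -
        have "(\<Sum>e\<in>E. metric_form V B [e] [vs ! b] * \<omega> us (vs[b := e])) =
            (\<Sum>e\<in>E. B e (vs ! b) * \<omega> us (vs[b := e]))"
          by (intro sum.cong) (auto simp: m E mem that)
        also have "\<dots> = \<omega> us (vs[b := \<Sum>e\<in>E. B e (vs ! b) *\<^sub>R e])"
          by (rule alternating_sum[OF alt(1) subspace_V, symmetric]) (use len sets that finite_E E_subset in auto)
        also have "\<dots> = \<omega> us vs"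
          using expansion[OF mem(2)[OF that]] by simp
        finally show ?thesis .
      qed
      then show ?thesis by (subst sum.swap) simp
    qed
    have 3: "(\<Sum>e\<in>E. \<Sum>a<k. metric_form V B [us ! a] [e] * \<omega> (us[a := e]) vs) = real k * \<omega> us vs"
    proof -
      have "(\<Sum>e\<in>E. metric_form V B [us ! a] [e] * \<omega> (us[a := e]) vs) = \<omega> us vs" if "a < k" for a
      proof -
        have "(\<Sum>e\<in>E. metric_form V B [us ! a] [e] * \<omega> (us[a := e]) vs) =
            (\<Sum>e\<in>E. B e (us ! a) * \<omega> (us[a := e]) vs)"
          by (intro sum.cong) (auto simp: m E mem that B_sym)
        also have "\<dots> = \<omega> (us[a := \<Sum>e\<in>E. B e (us ! a) *\<^sub>R e]) vs"
          by (rule alternating_sum[OF alt(2) subspace_V, symmetric]) (use len sets that finite_E E_subset in auto)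
        also have "\<dots> = \<omega> us vs"
          using expansion[OF mem(1)[OF that]] by simp
        finally show ?thesis .
      qed
      then show ?thesis by (subst sum.swap) simp
    qed
    have 4: "(\<Sum>e\<in>E. \<Sum>a<k. \<Sum>b<k. metric_form V B [us ! a] [vs ! b] * \<omega> (us[a := e]) (vs[b := e])) =
        L (contraction E \<omega>) us vs"
    proof -
      have "pull_sign a * pull_sign b * metric_form V B [us ! a] [vs ! b] *
            contraction E \<omega> (pull_out a us) (pull_out b vs) =
          (\<Sum>e\<in>E. metric_form V B [us ! a] [vs ! b] * \<omega> (us[a := e]) (vs[b := e]))"
        if "a < k" "b < k" for a b
      proof -
        have eq: "pull_sign a * (pull_sign b * \<omega> (e # pull_out a us) (e # pull_out b vs)) =
            \<omega> (us[a := e]) (vs[b := e])" for e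
          using that len by (simp add: alternating_Cons_pull_out[OF alt(1) subspace_V]
            alternating_Cons_pull_out[OF alt(2) subspace_V])
        show ?thesis
          by (simp add: contraction_def sum_distrib_left mult_ac flip: eq)
      qed
      then have "L (contraction E \<omega>) us vs =
          (\<Sum>a<k. \<Sum>b<k. \<Sum>e\<in>E. metric_form V B [us ! a] [vs ! b] * \<omega> (us[a := e]) (vs[b := e]))"
        using len by (simp add: one_one_mult_def)
      also have "\<dots> = (\<Sum>a<k. \<Sum>e\<in>E. \<Sum>b<k. metric_form V B [us ! a] [vs ! b] * \<omega> (us[a := e]) (vs[b := e]))"
        by (intro sum.cong refl sum.swap)
      also have "\<dots> = (\<Sum>e\<in>E. \<Sum>a<k. \<Sum>b<k. metric_form V B [us ! a] [vs ! b] * \<omega> (us[a := e]) (vs[b := e]))"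
        by (rule sum.swap)
      finally show ?thesis by simp
    qed
    have "contraction E (L \<omega>) us vs = real (card E) * \<omega> us vs - real k * \<omega> us vs - real k * \<omega> us vs +
        L (contraction E \<omega>) us vs"
      unfolding contraction_def[of E "L \<omega>"] L_Cons[OF len] sum.distrib sum_subtractf 1 2 3 4 ..
    then show ?thesis
      by (simp add: scaleR_fun_def algebra_simps)
  qed
qed

sublocale lefschetz_operators L "contraction E" "double_forms V" "card E"
proof (rule lefschetz_operators.intro)
  show "card E < k \<Longrightarrow> double_forms V k = {0}" for k
    using span_E by (intro double_forms_above_dim[OF subspace_V finite_E]) auto
qed (fact linear_one_one_mult linear_contraction subspace_double_forms L_double_form
    contraction_double_form[OF E_subset] contraction_degree_0 contraction_L)+

lemma dform_prod_one:
  assumes "\<eta> \<in> double_forms V q"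
  shows "dform_prod 0 q (metric_power V B 0) \<eta> = \<eta>"
proof (intro ext)
  fix xs ys
  note alt = double_forms_alternating[OF assms]
  show "dform_prod 0 q (metric_power V B 0) \<eta> xs ys = \<eta> xs ys"
  proof (cases "length xs = q \<and> length ys = q")
    case True
    have self: "alternation q \<theta> zs = fact q * \<theta> zs"
      if "\<theta> \<in> alternating_forms V q" "length zs = q" for \<theta> zs
    proof -
      have "of_int (sign \<sigma>) * \<theta> (permute_list \<sigma> zs) = \<theta> zs" if "\<sigma> permutes {..<q}" for \<sigma>
        using alternating_permute_list[OF \<open>\<theta> \<in> _\<close> subspace_V, of \<sigma> zs] that \<open>length zs = q\<close>
        by (simp add: sign_def)
      then show ?thesis by (simp add: alternation_def card_permutations)
    qed
    have "alternation q (\<lambda>zs. alternation q (\<eta> zs) ys) xs = fact q * (fact q * \<eta> xs ys)"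
      using True by (simp add: self[OF alt(1)] self[OF alt(2)] alternation_scale)
    then show ?thesis
      using True by (simp add: dform_prod_alternation power2_eq_square)
  next
    case False
    then show ?thesis
      using double_forms_outside[OF assms, of xs ys] by (auto simp: dform_prod_def)
  qed
qed

text \<open>Associativity moves the factors of \<open>g\<^sup>i\<close> onto \<open>\<eta>\<close> one after the other.\<close>

lemma metric_power_mult:
  assumes "\<eta> \<in> double_forms V q"
  shows "dform_prod i q (metric_power V B i) \<eta> = (L ^^ i) \<eta>"
proof (induction i)
  case (Suc i)
  have "dform_prod (Suc i) q (metric_power V B (Suc i)) \<eta> =
      dform_prod 1 (i + q) (metric_form V B) ((L ^^ i) \<eta>)"
    using dform_prod_assoc[of 1 i q "metric_form V B" "metric_power V B i" \<eta>] Suc by simp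
  also have "\<dots> = L ((L ^^ i) \<eta>)"
    using L_power_raises[OF assms, of i] by (intro dform_prod_one_one[OF subspace_V]) (simp add: add.commute)
  finally show ?case by simp
qed (use dform_prod_one[OF assms] in simp)

end

section \<open>The tangent spaces of a smooth manifold\<close>

lemma image_chart_open:
  fixes c d :: "('m, 'e::euclidean_space) chart"
  assumes "is_chart X c" and "is_chart X d"
  shows "open (snd c ` (fst c \<inter> fst d))"
proof -
  obtain V where V: "open V" "homeomorphic_map (subtopology X (fst c)) (top_of_set V) (snd c)"
    and c: "openin X (fst c)"
    using assms(1) unfolding is_chart_def by auto
  have d: "openin X (fst d)" using assms(2) unfolding is_chart_def by auto
  have "openin (subtopology X (fst c)) (fst c \<inter> fst d)"
    using d by (metis inf_commute openin_subtopology_Int)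
  then have "openin (top_of_set V) (snd c ` (fst c \<inter> fst d))"
    using homeomorphic_imp_open_map[OF V(2)] by (simp add: open_map_def)
  then show ?thesis using V(1) by (simp add: openin_open_eq)
qed

lemma chart_inv_apply:
  assumes "is_chart X c" and "m \<in> fst c"
  shows "chart_inv c (snd c m) = m"
proof -
  have "topspace (subtopology X (fst c)) = fst c"
    using assms(1) unfolding is_chart_def by (metis openin_subset topspace_subtopology_subset)
  then have "inj_on (snd c) (fst c)"
    using assms(1) unfolding is_chart_def by (metis homeomorphic_imp_injective_map)
  then show ?thesis
    unfolding chart_inv_def using assms(2) by (rule inv_into_f_f)
qed

lemma transition_apply:
  assumes "is_chart X c" and "m \<in> fst c"
  shows "transition c d (snd c m) = snd d m"
  using chart_inv_apply[OF assms] by (simp add: transition_def)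

lemma transition_differentiable:
  assumes "smooth_manifold X A" "c \<in> A" "d \<in> A" "x \<in> fst c" "x \<in> fst d"
  shows "transition c d differentiable (at (snd c x))"
proof -
  have "Ck_on (Suc 0) (snd c ` (fst c \<inter> fst d)) (transition c d)"
    using assms(1-3) unfolding smooth_manifold_def smooth_on_def by blast
  then show ?thesis using assms(4,5) by auto
qed

lemma transition_self_derivative:
  assumes "is_chart X c" "x \<in> fst c"
  shows "frechet_derivative (transition c c) (at (snd c x)) u = u"
proof -
  have "((\<lambda>y. y) has_derivative (\<lambda>u. u)) (at (snd c x))" by (rule has_derivative_ident)
  then have "(transition c c has_derivative (\<lambda>u. u)) (at (snd c x))"
    by (rule has_derivative_transform_within_open[OF _ image_chart_open[OF assms(1) assms(1)]])
      (use assms in \<open>auto simp: transition_apply[OF assms(1)]\<close>)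
  from frechet_derivative_at[OF this] show ?thesis by metis
qed

lemma transition_chain_rule:
  assumes M: "smooth_manifold X A" and A: "c \<in> A" "d \<in> A" "e \<in> A" and x: "x \<in> fst c" "x \<in> fst d" "x \<in> fst e"
  shows "frechet_derivative (transition d e) (at (snd d x))
      (frechet_derivative (transition c d) (at (snd c x)) u) =
    frechet_derivative (transition c e) (at (snd c x)) u"
proof -
  have ch: "is_chart X c" "is_chart X d" "is_chart X e"
    using M A unfolding smooth_manifold_def by auto
  have cx: "transition c d (snd c x) = snd d x"
    by (rule transition_apply[OF ch(1) x(1)])
  have cd: "(transition c d has_derivative frechet_derivative (transition c d) (at (snd c x))) (at (snd c x))"
    using transition_differentiable[OF M A(1,2) x(1,2)] by (simp add: frechet_derivative_works)
  have de: "(transition d e has_derivative frechet_derivative (transition d e) (at (snd d x)))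
      (at (transition c d (snd c x)))"
    using transition_differentiable[OF M A(2,3) x(2,3)] by (simp add: frechet_derivative_works cx)
  have "(transition d e \<circ> transition c d has_derivative
      frechet_derivative (transition d e) (at (snd d x)) \<circ>
      frechet_derivative (transition c d) (at (snd c x))) (at (snd c x))"
    by (rule diff_chain_at[OF cd de])
  then have "(transition c e has_derivative
      frechet_derivative (transition d e) (at (snd d x)) \<circ>
      frechet_derivative (transition c d) (at (snd c x))) (at (snd c x))"
    by (rule has_derivative_transform_within_open[OF _ image_chart_open[OF ch(1) ch(2)]])
      (use x in \<open>auto simp: transition_apply[OF ch(1)] transition_apply[OF ch(2)]\<close>)
  from frechet_derivative_at[OF this] show ?thesis by (metis comp_apply)
qed

text \<open>A tangent vector is determined by its coordinate vector in one chart, and every coordinate vector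
occurs: by the chain rule the images under the derivatives of the transition maps are
compatible. Thus the tangent space is a linear copy of the model space.\<close>

lemma tangent_space_coords:
  fixes A :: "('m, 'e::euclidean_space) chart set"
  assumes M: "smooth_manifold X A" and c: "c \<in> A" "x \<in> fst c"
  shows "linear (tangent_of_coords A c x)" and "inj (tangent_of_coords A c x)"
    and "range (tangent_of_coords A c x) = tangent_space A x"
proof -
  have ch: "is_chart X c"
    using M c unfolding smooth_manifold_def by auto
  have lin: "linear (frechet_derivative (transition c d) (at (snd c x)))" if "d \<in> A" "x \<in> fst d" for d
    using transition_differentiable[OF M c(1) that(1) c(2) that(2)] by (rule linear_frechet_derivative)
  show "linear (tangent_of_coords A c x)"
    unfolding linear_iff tangent_of_coords_def fun_eq_iff scaleR_fun_def
    using lin by (auto simp: linear_add linear_scale)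
  have self: "tangent_of_coords A c x u c = u" for u
    using c transition_self_derivative[OF ch c(2)] by (simp add: tangent_of_coords_def)
  then show "inj (tangent_of_coords A c x)"
    by (metis injI)
  show "range (tangent_of_coords A c x) = tangent_space A x"
  proof
    have "tangent_of_coords A c x u \<in> tangent_space A x" for u
      unfolding tangent_space_def mem_Collect_eq
    proof (intro conjI ballI allI impI)
      fix d e assume "d \<in> A" "e \<in> A" "x \<in> fst d \<inter> fst e"
      then show "tangent_of_coords A c x u e =
          frechet_derivative (transition d e) (at (snd d x)) (tangent_of_coords A c x u d)"
        by (simp add: tangent_of_coords_def transition_chain_rule[OF M c(1) _ _ c(2)])
    qed (auto simp: tangent_of_coords_def)
    then show "range (tangent_of_coords A c x) \<subseteq> tangent_space A x" by blast
    show "tangent_space A x \<subseteq> range (tangent_of_coords A c x)"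
    proof
      fix v assume v: "v \<in> tangent_space A x"
      have "v d = tangent_of_coords A c x (v c) d" for d
      proof (cases "d \<in> A \<and> x \<in> fst d")
        case True
        have "\<forall>d\<in>A. x \<in> fst c \<inter> fst d \<longrightarrow>
            v d = frechet_derivative (transition c d) (at (snd c x)) (v c)"
          using v c(1) unfolding tangent_space_def by blast
        with True c(2) show ?thesis by (simp add: tangent_of_coords_def)
      next
        case False
        have "\<forall>d. \<not> (d \<in> A \<and> x \<in> fst d) \<longrightarrow> v d = 0"
          using v unfolding tangent_space_def by blast
        with False have "v d = 0" by blast
        with False show ?thesis by (auto simp: tangent_of_coords_def)
      qed
      then have "v = tangent_of_coords A c x (v c)" ..
      then show "v \<in> range (tangent_of_coords A c x)" by blast
    qed
  qed
qed

lemma tangent_space_finite_dim: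
  fixes A :: "('m, 'e::euclidean_space) chart set"
  assumes "smooth_manifold X A" and "x \<in> topspace X"
  obtains S where "finite S" "independent S" "tangent_space A x = span S" "card S = DIM('e)"
proof -
  obtain c where "c \<in> A" "x \<in> fst c"
    using assms unfolding smooth_manifold_def by blast
  note h = tangent_space_coords[OF assms(1) this]
  let ?S = "tangent_of_coords A c x ` Basis"
  show thesis
  proof
    show "finite ?S" by simp
    show "independent ?S"
      by (rule linear_independent_injective_image[OF h(1) independent_Basis inj_on_subset[OF h(2)]]) simp
    show "tangent_space A x = span ?S"
      using h(1,3) linear_span_image[of "tangent_of_coords A c x" Basis] span_Basis by simp
    show "card ?S = DIM('e)"
      using h(2) by (metis card_image inj_on_subset subset_UNIV)
  qed
qed

section \<open>The Lefschetz property of the bundle of double forms\<close>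

theorem proposition2p1:
  fixes X :: "'m topology"
    and A :: "('m, 'e::euclidean_space) chart set"
    and g :: "'m \<Rightarrow> ('m, 'e) tangent_vector \<Rightarrow> ('m, 'e) tangent_vector \<Rightarrow> real"
    and n p :: nat
  assumes "smooth_manifold X A"
    and "riemannian_metric X A g"
    and "n = DIM('e)"
    and "1 \<le> p" and "p \<le> n"
    and "n < 2 * p"
  shows "(\<forall>x\<in>topspace X.
            D_fibre A p x = g_mult A g x (2 * p - n) (n - p) ` D_fibre A (n - p) x) \<and>
         (\<forall>x\<in>topspace X. \<forall>\<omega>\<in>D_fibre A p x. \<forall>\<omega>'.
            (\<forall>i\<le>p. \<omega>' (p - i) \<in> E_fibre A g (p - i) x) \<and>
            \<omega> = (\<Sum>i=0..p. g_mult A g x i (p - i) (\<omega>' (p - i))) \<longrightarrow>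
            (\<forall>k. n - p < k \<and> k \<le> p \<longrightarrow> g_mult A g x (p - k) k (\<omega>' k) = 0))"
proof -
  have fibre: "D_fibre A p x = g_mult A g x (2 * p - n) (n - p) ` D_fibre A (n - p) x \<and>
      (\<forall>k \<eta>. \<eta> \<in> E_fibre A g k x \<and> n - p < k \<and> k \<le> p \<longrightarrow> g_mult A g x (p - k) k \<eta> = 0)"
    if x: "x \<in> topspace X" for x
  proof -
    define V where "V = tangent_space A x"
    define B where "B = g x"
    define E where "E = (SOME E. orthonormal_basis V B E)"
    have inner: "inner_product_on V B"
      using assms(2) x by (simp add: riemannian_metric_def V_def B_def)
    obtain S where S: "finite S" "independent S" "V = span S" "card S = n"
      using tangent_space_finite_dim[OF assms(1) x] assms(3) unfolding V_def by metis
    have "\<exists>E. orthonormal_basis V B E"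
      using S subspace_span[of S] by (intro orthonormal_basis_exists[OF inner, of S]) auto
    then have "orthonormal_basis V B E"
      unfolding E_def by (rule someI_ex)
    with inner interpret orthonormal_frame V B E
      by unfold_locales
    have n: "card E = n"
      using card_E[OF S(1-3)] S(4) by simp
    have g_mult: "g_mult A g x i q \<eta> = (L ^^ i) \<eta>" if "\<eta> \<in> double_forms V q" for i q \<eta>
      using metric_power_mult[OF that, of i] by (simp add: g_mult_def V_def B_def)
    have C: "ricci_contraction V B = contraction E"
      by (simp add: fun_eq_iff ricci_contraction_def contraction_def E_def)
    have "D_fibre A p x = g_mult A g x (2 * p - n) (n - p) ` D_fibre A (n - p) x"
      using L_power_onto[of p] assms(5,6) g_mult
      by (simp add: n D_fibre_def flip: V_def cong: image_cong)
    moreover have "g_mult A g x (p - k) k \<eta> = 0"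
      if "\<eta> \<in> E_fibre A g k x" "n - p < k" "k \<le> p" for k \<eta>
    proof -
      have "\<eta> \<in> double_forms V k" "contraction E \<eta> = 0"
        using that(1) by (simp_all add: E_fibre_def trace_free_forms_def C flip: V_def B_def)
      then show ?thesis
        using L_power_primitive[of \<eta> k "p - k"] that(2,3) by (simp add: g_mult n)
    qed
    ultimately show ?thesis by blast
  qed
  have "g_mult A g x (p - k) k (\<omega>' k) = 0"
    if "x \<in> topspace X" "\<forall>i\<le>p. \<omega>' (p - i) \<in> E_fibre A g (p - i) x" "n - p < k" "k \<le> p" for x \<omega>' k
  proof -
    have "\<omega>' k \<in> E_fibre A g k x"
      using that(2)[rule_format, of "p - k"] that(4) by simp
    with fibre[OF that(1)] that(3,4) show ?thesis by blast
  qed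
  with fibre show ?thesis by blast
qed

end
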